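(* Let $A\in\mathbb{Z}^{d\times n}$ have rank $d$ with columns lying in an affine hyperplane of $\mathbb{Q}^d$ not containing the origin, let $\beta\in\mathbb{C}^d$, and let $w\in\mathbb{R}^n$ be a generic weight vector. For every fake exponent $v$ of $H_A(\beta)$ with respect to $w$, $$\sum_{q\geq0}\dim_{\mathbb{C}}(Q_v^{\perp})_q\,t^q=H_{w,v}(t).$$ Consequently, $$\max\{q\geq0\mid(Q_v^{\perp})_q\neq0\}=\operatorname{fdeg}_w(v)\quad\text{and}\quad\operatorname{frank}_w(v)=H_{w,v}(1).$$
   Context: Notation: $\mathbb{N}=\{0,1,2,\ldots\}$, $[n]=\{1,\ldots,n\}$, $L=\ker_{\mathbb{Z}}(A)$. The toric ideal is $I_A=\langle\partial^u-\partial^{u'}\mid Au=Au',\ u,u'\in\mathbb{N}^n\rangle\subseteq\mathbb{C}[\partial_1,\ldots,\partial_n]$. $\operatorname{in}_w(I_A)$ is the ideal generated by the $w$-initial forms (sums of terms of maximal $w$-weight) of elements of $I_A$; "$w$ generic" means in particular that $\operatorname{in}_w(I_A)$ is a monomial ideal. Let $D=\mathbb{C}\langle x_1,\ldots,x_n,\partial_1,\ldots,\partial_n\rangle$ be the Weyl algebra and $\vartheta_j=x_j\partial_j$. $H_A(\beta)$ is the left ideal of $D$ generated by $I_A$ and the Euler operators $\sum_j a_{ij}\vartheta_j-\beta_i$. The fake indicial ideal is $(D\cdot\operatorname{in}_w(I_A)\cap\mathbb{C}[\vartheta])+\langle A\vartheta-\beta\rangle\subseteq\mathbb{C}[\vartheta]$;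 a zero $v\in\mathbb{C}^n$ of it is called a fake exponent of $H_A(\beta)$ with respect to $w$. $\operatorname{nsupp}(z)=\{j\in[n]\mid z_j\in\mathbb{Z}_{<0}\}$ for $z\in\mathbb{C}^n$. For $u\in L$ put $I_u=\operatorname{nsupp}(v+u)$, so $I_0=\operatorname{nsupp}(v)$; put $V=[n]\setminus I_0$. A standard pair of a monomial ideal $M\subseteq\mathbb{C}[\partial]$ is a pair $(a,\sigma)$, $a\in\mathbb{N}^n$, $\sigma\subseteq[n]$, such that (i) $a_i=0$ for $i\in\sigma$; (ii) $\partial^a\prod_{j\in\sigma}\partial_j^{b_j}\notin M$ for all $b_j\in\mathbb{N}$; (iii) for every $\ell\notin\sigma$ there are $b_j\in\mathbb{N}$ ($j\in\sigma\cup\{\ell\}$) with $\partial^a\prod_{j\in\sigma\cup\{\ell\}}\partial_j^{b_j}\in M$. $\mathcal{S}(M)$ is the set of standard pairs, and $\mathcal{S}_w(v)=\{(a,\sigma)\in\mathcal{S}(\operatorname{in}_w(I_A))\mid v_j=a_j\text{ for every }j\notin\sigma\}$. (Known criterion: $v$ is a fake exponent iff $Av=\beta$ and $\mathcal{S}_w(v)\neq\emptyset$.) $\Delta_w(v)=\{\tau\subseteq[n]\mid\tau\subseteq\sigma\text{ for some }(a,\sigma)\in\mathcal{S}_w(v)\}$, and $\operatorname{link}_v=\{\tau\in\Delta_w(v)\mid\tau\cap I_0=\emptyset,\ \tau\cup I_0\in\Delta_w(v)\}$, regarded as a simplicial complex on the vertex set $V$ (some elements of $V$ may be nonfaces). For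 a simplicial complex $\Delta$ on $V$, $I_\Delta=\langle\prod_{i\in\tau}x_i\mid\tau\subseteq V,\ \tau\notin\Delta\rangle$ and $\mathbb{C}[\Delta]=\mathbb{C}[x_i\mid i\in V]/I_\Delta$. Let $\{\partial^{g_+^{(i)}}-\partial^{g_-^{(i)}}\mid i=1,\ldots,m\}$ be the reduced Gröbner basis of $I_A$ with respect to $w$, with $\partial^{g_+^{(i)}}\in\operatorname{in}_w(I_A)$; put $g^{(i)}=g_+^{(i)}-g_-^{(i)}$ and $G^{(i)}=I_{-g^{(i)}}\setminus I_0$. Let $T=\mathbb{C}[\theta_1,\ldots,\theta_n]$, $\langle A\theta\rangle=\langle\sum_j a_{ij}\theta_j\mid i=1,\ldots,d\rangle$, $M_\theta(v)=\langle\prod_{j\in G^{(i)}}\theta_j\mid i=1,\ldots,m\rangle$, and $Q_v=\langle A\theta\rangle+M_\theta(v)\subseteq T$. For a homogeneous ideal $Q\subseteq T$, $Q^\perp=\{f\in\mathbb{C}[z_1,\ldots,z_n]\mid\phi(\partial_z)\bullet f=0\text{ for all }\phi\in Q\}$, and $(Q^\perp)_q$ is its degree-$q$ part. Write $k=|I_0|$, $I_0=\{i_1,\ldots,i_k\}$. By row reduction, $\langle A\theta\rangle$ has generators $\theta_{i_p}-L_p(\theta_V)$ ($1\le p\le k$), $\ell_q(\theta_V)$ ($1\le q\le d-k$), with $L_p,\ell_q$ linear forms in the variables $\theta_j$, $j\in V$. Via $\theta_j\mapsto x_j$ regard $\ell_q\in\mathbb{C}[\operatorname{link}_v]$, and define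 $$\mathcal{A}_{w,v}=\mathbb{C}[\operatorname{link}_v]/(\ell_1,\ldots,\ell_{d-|I_0|}),\qquad H_{w,v}(t)=\operatorname{Hilb}(\mathcal{A}_{w,v},t),$$ the Hilbert series, which is a polynomial since $\mathcal{A}_{w,v}$ is finite-dimensional, and does not depend on the choice of the $L_p,\ell_q$. Finally $\operatorname{fdeg}_w(v)=\deg H_{w,v}(t)$ and $\operatorname{frank}_w(v)=\dim_{\mathbb{C}}Q_v^\perp$. *)

theory Defs
  imports
    "HOL-Analysis.Analysis"
    "HOL-Library.Poly_Mapping"
    "HOL-Computational_Algebra.Polynomial_FPS"
begin

type_synonym 'n expo = "'n \<Rightarrow>\<^sub>0 nat"
type_synonym 'n mpoly = "('n \<Rightarrow>\<^sub>0 nat) \<Rightarrow>\<^sub>0 complex"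

definition mon :: "'n expo \<Rightarrow> 'n mpoly" where
  "mon u = Poly_Mapping.single u 1"

definition pconst :: "complex \<Rightarrow> 'n mpoly" where
  "pconst c = Poly_Mapping.single 0 c"

definition pvar :: "'n \<Rightarrow> 'n mpoly" where
  "pvar j = mon (Poly_Mapping.single j 1)"

definition cscale :: "complex \<Rightarrow> 'n mpoly \<Rightarrow> 'n mpoly" where
  "cscale c p = pconst c * p"

lemma vector_space_cscale: "vector_space cscale"
  by unfold_locales
     (simp_all add: cscale_def pconst_def algebra_simps single_add mult_single
        flip: mult.assoc)

global_interpretation cpoly: vector_space "cscale :: complex \<Rightarrow> 'n mpoly \<Rightarrow> 'n mpoly"
  by (rule vector_space_cscale)

definition eval_mpoly :: "complex ^ 'n::finite \<Rightarrow> 'n mpoly \<Rightarrow> complex" where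
  "eval_mpoly v p =
     (\<Sum>u\<in>Poly_Mapping.keys p. Poly_Mapping.lookup p u *
        (\<Prod>j\<in>UNIV. (v $ j) ^ Poly_Mapping.lookup u j))"

definition expo_degree :: "'n::finite expo \<Rightarrow> nat" where
  "expo_degree u = (\<Sum>j\<in>UNIV. Poly_Mapping.lookup u j)"

definition homogeneous_part :: "nat \<Rightarrow> 'n::finite mpoly set" where
  "homogeneous_part q = {p. \<forall>u\<in>Poly_Mapping.keys p. expo_degree u = q}"

text \<open>The ideal generated by a set, as the span in the ring regarded as a module over itself.\<close>

definition ideal_gen :: "'a::comm_ring_1 set \<Rightarrow> 'a set" where
  "ideal_gen S = module.span (*) S"

definition ideal_sum :: "'a::comm_ring_1 set \<Rightarrow> 'a set \<Rightarrow> 'a set" where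
  "ideal_sum I J = {p + q | p q. p \<in> I \<and> q \<in> J}"

definition monomial_ideal :: "'n mpoly set \<Rightarrow> bool" where
  "monomial_ideal M \<longleftrightarrow> (\<exists>U. M = ideal_gen (mon ` U))"

definition homogeneous_matrix :: "int ^ 'n ^ 'd::finite \<Rightarrow> bool" where
  "homogeneous_matrix A \<longleftrightarrow>
     (\<exists>(h :: rat ^ 'd) c. h \<noteq> 0 \<and> c \<noteq> 0 \<and>
        (\<forall>j. (\<Sum>i\<in>UNIV. h $ i * of_int (A $ i $ j)) = c))"

definition rat_matrix :: "int ^ 'n::finite ^ 'd::finite \<Rightarrow> rat ^ 'n ^ 'd" where
  "rat_matrix A = (\<chi> i j. of_int (A $ i $ j))"

definition mult_expo :: "int ^ 'n::finite ^ 'd::finite \<Rightarrow> 'n expo \<Rightarrow> int ^ 'd" where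
  "mult_expo A u = (\<chi> i. \<Sum>j\<in>UNIV. A $ i $ j * int (Poly_Mapping.lookup u j))"

definition toric_ideal :: "int ^ 'n::finite ^ 'd::finite \<Rightarrow> 'n mpoly set" where
  "toric_ideal A = ideal_gen {mon u - mon u' | u u'. mult_expo A u = mult_expo A u'}"

definition weight :: "real ^ 'n::finite \<Rightarrow> 'n expo \<Rightarrow> real" where
  "weight w u = (\<Sum>j\<in>UNIV. w $ j * real (Poly_Mapping.lookup u j))"

definition initial_form :: "real ^ 'n::finite \<Rightarrow> 'n mpoly \<Rightarrow> 'n mpoly" where
  "initial_form w f =
     (\<Sum>u\<in>{u \<in> Poly_Mapping.keys f. \<forall>u'\<in>Poly_Mapping.keys f. weight w u' \<le> weight w u}.
        Poly_Mapping.single u (Poly_Mapping.lookup f u))"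

definition initial_ideal :: "real ^ 'n::finite \<Rightarrow> 'n mpoly set \<Rightarrow> 'n mpoly set" where
  "initial_ideal w I = ideal_gen (initial_form w ` I)"

definition generic_weight :: "int ^ 'n::finite ^ 'd::finite \<Rightarrow> real ^ 'n \<Rightarrow> bool" where
  "generic_weight A w \<longleftrightarrow> monomial_ideal (initial_ideal w (toric_ideal A))"

definition is_reduced_groebner_basis ::
    "real ^ 'n::finite \<Rightarrow> 'n mpoly set \<Rightarrow> 'n mpoly set \<Rightarrow> bool" where
  "is_reduced_groebner_basis w I G \<longleftrightarrow>
     finite G \<and> ideal_gen G = I \<and>
     ideal_gen (initial_form w ` G) = initial_ideal w I \<and>
     (\<forall>g\<in>G. (\<exists>u. initial_form w g = mon u) \<and>
        (\<forall>t\<in>Poly_Mapping.keys g. mon t \<notin> ideal_gen (initial_form w ` (G - {g}))))"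

definition pderivative :: "'n \<Rightarrow> 'n mpoly \<Rightarrow> 'n mpoly" where
  "pderivative j f =
     (\<Sum>u\<in>Poly_Mapping.keys f.
        Poly_Mapping.single (u - Poly_Mapping.single j 1)
          (Poly_Mapping.lookup f u * of_nat (Poly_Mapping.lookup u j)))"

definition euler_op :: "'n \<Rightarrow> 'n mpoly \<Rightarrow> 'n mpoly" where
  "euler_op j f = pvar j * pderivative j f"

text \<open>The Weyl algebra is realised, as is possible in characteristic 0, as the algebra of
  differential operators with polynomial coefficients acting on the polynomial ring;
  the product is composition.\<close>

inductive_set weyl_algebra :: "('n mpoly \<Rightarrow> 'n mpoly) set" where
  const: "cscale c \<in> weyl_algebra"
| var: "(\<lambda>f. pvar j * f) \<in> weyl_algebra"
| deriv: "pderivative j \<in> weyl_algebra"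
| add: "P \<in> weyl_algebra \<Longrightarrow> Q \<in> weyl_algebra \<Longrightarrow> (\<lambda>f. P f + Q f) \<in> weyl_algebra"
| mult: "P \<in> weyl_algebra \<Longrightarrow> Q \<in> weyl_algebra \<Longrightarrow> P \<circ> Q \<in> weyl_algebra"

definition weyl_left_ideal ::
    "('n mpoly \<Rightarrow> 'n mpoly) set \<Rightarrow> ('n mpoly \<Rightarrow> 'n mpoly) set" where
  "weyl_left_ideal S =
     {(\<lambda>f. \<Sum>i<k. P i (Q i f)) | (k::nat) P Q. \<forall>i<k. P i \<in> weyl_algebra \<and> Q i \<in> S}"

text \<open>Substitution of pairwise commuting operators for the variables of a polynomial.
  The fold is the composition of the powers; its order is immaterial
  because the operators commute.\<close>

definition op_monomial ::
    "('n::finite \<Rightarrow> 'n mpoly \<Rightarrow> 'n mpoly) \<Rightarrow> 'n expo \<Rightarrow> 'n mpoly \<Rightarrow> 'n mpoly" where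
  "op_monomial X u = Finite_Set.fold (\<lambda>j F. (X j ^^ Poly_Mapping.lookup u j) \<circ> F) id UNIV"

definition op_subst ::
    "('n::finite \<Rightarrow> 'n mpoly \<Rightarrow> 'n mpoly) \<Rightarrow> 'n mpoly \<Rightarrow> 'n mpoly \<Rightarrow> 'n mpoly" where
  "op_subst X p f =
     (\<Sum>u\<in>Poly_Mapping.keys p. cscale (Poly_Mapping.lookup p u) (op_monomial X u f))"

definition row_form :: "int ^ 'n::finite ^ 'd::finite \<Rightarrow> 'd \<Rightarrow> 'n mpoly" where
  "row_form A i = (\<Sum>j\<in>UNIV. pconst (of_int (A $ i $ j)) * pvar j)"

definition fake_indicial_ideal ::
    "int ^ 'n::finite ^ 'd::finite \<Rightarrow> complex ^ 'd \<Rightarrow> real ^ 'n \<Rightarrow> 'n mpoly set" where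
  "fake_indicial_ideal A \<beta> w =
     ideal_sum
       {p. op_subst euler_op p \<in>
             weyl_left_ideal (op_subst pderivative ` initial_ideal w (toric_ideal A))}
       (ideal_gen (range (\<lambda>i. row_form A i - pconst (\<beta> $ i))))"

definition fake_exponent ::
    "int ^ 'n::finite ^ 'd::finite \<Rightarrow> complex ^ 'd \<Rightarrow> real ^ 'n \<Rightarrow> complex ^ 'n \<Rightarrow> bool" where
  "fake_exponent A \<beta> w v \<longleftrightarrow> (\<forall>p\<in>fake_indicial_ideal A \<beta> w. eval_mpoly v p = 0)"

definition nsupp :: "complex ^ 'n \<Rightarrow> 'n set" where
  "nsupp z = {j. \<exists>m::int. m < 0 \<and> z $ j = of_int m}"

definition nsupp_shift :: "complex ^ 'n::finite \<Rightarrow> int ^ 'n \<Rightarrow> 'n set" where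
  "nsupp_shift v u = nsupp (\<chi> j. v $ j + of_int (u $ j))"

definition standard_pairs :: "'n mpoly set \<Rightarrow> ('n expo \<times> 'n set) set" where
  "standard_pairs M = {(a, \<sigma>).
     (\<forall>i\<in>\<sigma>. Poly_Mapping.lookup a i = 0) \<and>
     (\<forall>b. Poly_Mapping.keys b \<subseteq> \<sigma> \<longrightarrow> mon (a + b) \<notin> M) \<and>
     (\<forall>l. l \<notin> \<sigma> \<longrightarrow> (\<exists>b. Poly_Mapping.keys b \<subseteq> insert l \<sigma> \<and> mon (a + b) \<in> M))}"

definition standard_pairs_at ::
    "int ^ 'n::finite ^ 'd::finite \<Rightarrow> real ^ 'n \<Rightarrow> complex ^ 'n \<Rightarrow> ('n expo \<times> 'n set) set" where
  "standard_pairs_at A w v =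
     {(a, \<sigma>) \<in> standard_pairs (initial_ideal w (toric_ideal A)).
        \<forall>j. j \<notin> \<sigma> \<longrightarrow> v $ j = of_nat (Poly_Mapping.lookup a j)}"

definition Delta_complex ::
    "int ^ 'n::finite ^ 'd::finite \<Rightarrow> real ^ 'n \<Rightarrow> complex ^ 'n \<Rightarrow> 'n set set" where
  "Delta_complex A w v = {\<tau>. \<exists>(a, \<sigma>)\<in>standard_pairs_at A w v. \<tau> \<subseteq> \<sigma>}"

definition link_complex ::
    "int ^ 'n::finite ^ 'd::finite \<Rightarrow> real ^ 'n \<Rightarrow> complex ^ 'n \<Rightarrow> 'n set set" where
  "link_complex A w v =
     {\<tau> \<in> Delta_complex A w v. \<tau> \<inter> nsupp v = {} \<and> \<tau> \<union> nsupp v \<in> Delta_complex A w v}"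

text \<open>A Groebner basis of binomials is given by the exponents
  \<^term>\<open>gp i\<close> and \<^term>\<open>gm i\<close> of its elements for \<^term>\<open>i \<in> {1..m::nat}\<close>.\<close>

definition G_set :: "complex ^ 'n::finite \<Rightarrow> 'n expo \<Rightarrow> 'n expo \<Rightarrow> 'n set" where
  "G_set v p m =
     nsupp_shift v (- (\<chi> j. int (Poly_Mapping.lookup p j) - int (Poly_Mapping.lookup m j)))
       - nsupp v"

definition M_ideal ::
    "complex ^ 'n::finite \<Rightarrow> nat \<Rightarrow> (nat \<Rightarrow> 'n expo) \<Rightarrow> (nat \<Rightarrow> 'n expo) \<Rightarrow> 'n mpoly set" where
  "M_ideal v m gp gm = ideal_gen ((\<lambda>i. \<Prod>j\<in>G_set v (gp i) (gm i). pvar j) ` {1..m})"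

definition Q_ideal ::
    "int ^ 'n::finite ^ 'd::finite \<Rightarrow> complex ^ 'n \<Rightarrow>
     nat \<Rightarrow> (nat \<Rightarrow> 'n expo) \<Rightarrow> (nat \<Rightarrow> 'n expo) \<Rightarrow> 'n mpoly set" where
  "Q_ideal A v m gp gm = ideal_sum (ideal_gen (range (row_form A))) (M_ideal v m gp gm)"

definition perp :: "'n::finite mpoly set \<Rightarrow> 'n mpoly set" where
  "perp Q = {f. \<forall>\<phi>\<in>Q. op_subst pderivative \<phi> f = 0}"

definition frank ::
    "int ^ 'n::finite ^ 'd::finite \<Rightarrow> complex ^ 'n \<Rightarrow>
     nat \<Rightarrow> (nat \<Rightarrow> 'n expo) \<Rightarrow> (nat \<Rightarrow> 'n expo) \<Rightarrow> nat" where
  "frank A v m gp gm = cpoly.dim (perp (Q_ideal A v m gp gm))"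

definition polys_in :: "'n set \<Rightarrow> 'n mpoly set" where
  "polys_in V = {p. \<forall>u\<in>Poly_Mapping.keys p. Poly_Mapping.keys u \<subseteq> V}"

definition linear_form_in :: "'n set \<Rightarrow> 'n mpoly \<Rightarrow> bool" where
  "linear_form_in V p \<longleftrightarrow> (\<exists>c. p = (\<Sum>j\<in>V. pconst (c j) * pvar j))"

text \<open>The ideal of the subring \<^term>\<open>polys_in V\<close> generated by a subset of that subring.\<close>

definition ideal_gen_in :: "'n set \<Rightarrow> 'n mpoly set \<Rightarrow> 'n mpoly set" where
  "ideal_gen_in V S =
     {(\<Sum>s\<in>F. r s * s) | F r. finite F \<and> F \<subseteq> S \<and> (\<forall>s\<in>F. r s \<in> polys_in V)}"

definition stanley_reisner_ideal :: "'n set \<Rightarrow> 'n set set \<Rightarrow> 'n mpoly set" where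
  "stanley_reisner_ideal V \<Delta> =
     ideal_gen_in V {(\<Prod>i\<in>\<tau>. pvar i) | \<tau>. \<tau> \<subseteq> V \<and> \<tau> \<notin> \<Delta>}"

text \<open>The dimension of the quotient space \<open>W / (W \<inter> U)\<close>: the number of elements of a finite
  family in \<open>W\<close> whose classes form a basis.\<close>

definition quot_dim :: "'n mpoly set \<Rightarrow> 'n mpoly set \<Rightarrow> nat" where
  "quot_dim W U =
     (THE n. \<exists>B. finite B \<and> B \<subseteq> W \<and> card B = n \<and>
        (\<forall>p\<in>W. \<exists>!c. (\<forall>b. b \<notin> B \<longrightarrow> c b = 0) \<and> p - (\<Sum>b\<in>B. cscale (c b) b) \<in> U))"

definition hilbert_series :: "'n::finite set \<Rightarrow> 'n mpoly set \<Rightarrow> int fps" where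
  "hilbert_series V J = Abs_fps (\<lambda>q. int (quot_dim (polys_in V \<inter> homogeneous_part q) J))"

text \<open>Row reduction of the ideal of the row forms of \<open>A\<close> with respect to \<open>I\<^sub>0\<close>; the forms
  expressing the variables in \<open>I\<^sub>0\<close> are indexed by \<open>I\<^sub>0\<close> itself.\<close>

definition row_reduction ::
    "int ^ 'n::finite ^ 'd::finite \<Rightarrow> 'n set \<Rightarrow> ('n \<Rightarrow> 'n mpoly) \<Rightarrow> (nat \<Rightarrow> 'n mpoly) \<Rightarrow> bool" where
  "row_reduction A I\<^sub>0 L ell \<longleftrightarrow>
     (\<forall>i\<in>I\<^sub>0. linear_form_in (- I\<^sub>0) (L i)) \<and>
     (\<forall>q\<in>{1..CARD('d) - card I\<^sub>0}. linear_form_in (- I\<^sub>0) (ell q)) \<and>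
     ideal_gen ((\<lambda>i. pvar i - L i) ` I\<^sub>0 \<union> ell ` {1..CARD('d) - card I\<^sub>0}) =
       ideal_gen (range (row_form A))"

text \<open>The kernel of the projection from the polynomial ring on \<open>V\<close> onto the quotient
  of the Stanley--Reisner ring of the link by the forms \<^term>\<open>ell q\<close>.\<close>

definition link_quotient_ideal ::
    "int ^ 'n::finite ^ 'd::finite \<Rightarrow> real ^ 'n \<Rightarrow> complex ^ 'n \<Rightarrow> (nat \<Rightarrow> 'n mpoly) \<Rightarrow>
     'n mpoly set" where
  "link_quotient_ideal A w v ell =
     ideal_sum (stanley_reisner_ideal (- nsupp v) (link_complex A w v))
       (ideal_gen_in (- nsupp v) (ell ` {1..CARD('d) - card (nsupp v)}))"

definition H_series ::
    "int ^ 'n::finite ^ 'd::finite \<Rightarrow> real ^ 'n \<Rightarrow> complex ^ 'n \<Rightarrow> (nat \<Rightarrow> 'n mpoly) \<Rightarrow>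
     int fps" where
  "H_series A w v ell = hilbert_series (- nsupp v) (link_quotient_ideal A w v ell)"

text \<open>The description is proper because the quotient is finite-dimensional.\<close>

definition H_poly ::
    "int ^ 'n::finite ^ 'd::finite \<Rightarrow> real ^ 'n \<Rightarrow> complex ^ 'n \<Rightarrow> (nat \<Rightarrow> 'n mpoly) \<Rightarrow>
     int poly" where
  "H_poly A w v ell = (THE p. fps_of_poly p = H_series A w v ell)"

definition fdeg ::
    "int ^ 'n::finite ^ 'd::finite \<Rightarrow> real ^ 'n \<Rightarrow> complex ^ 'n \<Rightarrow> (nat \<Rightarrow> 'n mpoly) \<Rightarrow> nat" where
  "fdeg A w v ell = degree (H_poly A w v ell)"

end

theory Submission
  imports Defs
begin

text \<open>
  The exponents \<open>g\<^sub>+\<close> and \<open>g\<^sub>-\<close> of an element of the reduced Groebner basis have disjoint supports, so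
  \<open>G\<^sup>(\<^sup>i\<^sup>)\<close> consists of the \<open>j\<close> with \<open>v\<^sub>j\<close> a natural number smaller than the \<open>j\<close>-th entry of \<open>g\<^sub>+\<close>.
  Hence a subset of the complement of \<open>I\<^sub>0\<close> is a nonface of the link iff it contains some \<open>G\<^sup>(\<^sup>i\<^sup>)\<close>, and
  \<open>M\<^sub>\<theta>(v)\<close> is the extension of the Stanley--Reisner ideal of the link. Substituting \<open>L\<^sub>p\<close> for the variables
  in \<open>I\<^sub>0\<close> identifies the quotient by \<open>Q\<^sub>v\<close> with the algebra defining the Hilbert series, and the pairing
  \<open>\<langle>\<phi>, f\<rangle> = (\<phi>(\<partial>)f)(0)\<close> makes the graded pieces of \<open>Q\<^sub>v\<^sup>\<bottom>\<close> dual to those of the quotient.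

  Since the columns of \<open>A\<close> indexed by the face of a standard pair are linearly independent, all monomials
  of degree above \<open>n\<close> lie in \<open>Q\<^sub>v\<close>. The constants lie in \<open>Q\<^sub>v\<^sup>\<bottom>\<close>: the polynomial of \<open>x\<^sup>u\<partial>\<^sup>u\<close> in the
  Euler operators, where \<open>u = g\<^sub>+\<close>, belongs to the fake indicial ideal, so it vanishes at \<open>v\<close>, which
  means that \<open>G\<^sup>(\<^sup>i\<^sup>)\<close> is nonempty.
\<close>

section \<open>Polynomials\<close>

text \<open>A polynomial is the sum of its terms, so additive statements need only be checked on
  single terms. There is no case for zero because the coefficient \<open>c\<close> may be 0.\<close>

lemma poly_mapping_add_induct [case_names single add]:
  fixes p :: "'a \<Rightarrow>\<^sub>0 'b::comm_monoid_add"
  assumes single: "\<And>u c. P (Poly_Mapping.single u c)"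
    and add: "\<And>p q. P p \<Longrightarrow> P q \<Longrightarrow> P (p + q)"
  shows "P p"
proof -
  have P_sum: "P (\<Sum>u\<in>S. Poly_Mapping.single u (f u))" if "finite S" for S and f :: "'a \<Rightarrow> 'b"
    using that
  proof (induction S)
    case empty
    show ?case using single[of undefined 0] by simp
  next
    case (insert x S)
    then show ?case by (simp add: add single)
  qed
  have "p = (\<Sum>u\<in>Poly_Mapping.keys p. Poly_Mapping.single u (Poly_Mapping.lookup p u))"
    by (rule poly_mapping_eqI)
       (simp add: lookup_sum lookup_single when_def in_keys_iff)
  with P_sum[OF finite_keys] show ?thesis by metis
qed

lemma sum_single_lookup:
  fixes u :: "'n::finite \<Rightarrow>\<^sub>0 nat"
  shows "(\<Sum>j\<in>UNIV. Poly_Mapping.single j (Poly_Mapping.lookup u j)) = u"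
  by (rule poly_mapping_eqI) (simp add: lookup_sum lookup_single when_def)

lemma single_conv_mon: "Poly_Mapping.single u c = pconst c * mon u"
  by (simp add: pconst_def mon_def mult_single)

lemma mon_mult: "mon u * mon u' = mon (u + u')"
  by (simp add: mon_def mult_single)

lemma cscale_single: "cscale a (Poly_Mapping.single u c) = Poly_Mapping.single u (a * c)"
  by (simp add: cscale_def pconst_def mult_single)

lemma lookup_cscale: "Poly_Mapping.lookup (cscale a p) u = a * Poly_Mapping.lookup p u"
  by (induction p rule: poly_mapping_add_induct)
     (simp_all add: cscale_single cpoly.scale_right_distrib lookup_add ring_distribs lookup_single when_def)

lemma lookup_mon: "Poly_Mapping.lookup (mon u) t = (if t = u then 1 else 0)"
  by (simp add: mon_def lookup_single when_def)

lemma keys_mon [simp]: "Poly_Mapping.keys (mon u) = {u}"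
  by (simp add: mon_def)

lemma mon_eq_iff [simp]: "mon u = mon u' \<longleftrightarrow> u = u'"
  by (metis keys_mon singleton_inject)

lemma mon_zero [simp]: "mon 0 = 1"
  by (simp add: mon_def)

lemma mon_sum: "mon (\<Sum>i\<in>S. f i) = (\<Prod>i\<in>S. mon (f i))"
  by (induction S rule: infinite_finite_induct) (simp_all flip: mon_mult)

section \<open>Ideals\<close>

lemma module_times: "module ((*) :: 'a::comm_ring_1 \<Rightarrow> 'a \<Rightarrow> 'a)"
  by unfold_locales (simp_all add: algebra_simps)

lemma ideal_gen_base: "s \<in> S \<Longrightarrow> s \<in> ideal_gen S"
  unfolding ideal_gen_def by (rule module.span_base[OF module_times])

lemma ideal_gen_zero: "0 \<in> ideal_gen S"
  unfolding ideal_gen_def by (rule module.span_zero[OF module_times])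

lemma ideal_gen_add: "p \<in> ideal_gen S \<Longrightarrow> q \<in> ideal_gen S \<Longrightarrow> p + q \<in> ideal_gen S"
  unfolding ideal_gen_def by (rule module.span_add[OF module_times])

lemma ideal_gen_diff: "p \<in> ideal_gen S \<Longrightarrow> q \<in> ideal_gen S \<Longrightarrow> p - q \<in> ideal_gen S"
  unfolding ideal_gen_def by (rule module.span_diff[OF module_times])

lemma ideal_gen_mult: "p \<in> ideal_gen S \<Longrightarrow> r * p \<in> ideal_gen S"
  unfolding ideal_gen_def by (rule module.span_scale[OF module_times])

lemma ideal_gen_sum: "(\<And>i. i \<in> I \<Longrightarrow> f i \<in> ideal_gen S) \<Longrightarrow> sum f I \<in> ideal_gen S"
  unfolding ideal_gen_def by (rule module.span_sum[OF module_times])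

lemma ideal_gen_cscale: "p \<in> ideal_gen S \<Longrightarrow> cscale c p \<in> ideal_gen S"
  unfolding cscale_def by (rule ideal_gen_mult)

lemma ideal_gen_induct [consumes 1, case_names zero step]:
  assumes "p \<in> ideal_gen S" and "P 0"
    and "\<And>r s p. s \<in> S \<Longrightarrow> P p \<Longrightarrow> P (r * s + p)"
  shows "P p"
  using assms(1) unfolding ideal_gen_def
  by (rule module.span_induct_alt[OF module_times]) (use assms in auto)

lemma ideal_gen_subset: "S \<subseteq> ideal_gen T \<Longrightarrow> ideal_gen S \<subseteq> ideal_gen T"
  unfolding ideal_gen_def by (rule module.span_minimal[OF module_times]) (simp_all add: module.subspace_span[OF module_times])

lemma ideal_sum_ideal_gen: "ideal_sum (ideal_gen S) (ideal_gen T) = ideal_gen (S \<union> T)"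
  unfolding ideal_sum_def ideal_gen_def by (rule module.span_Un[OF module_times, symmetric])

lemma subspace_ideal_gen: "cpoly.subspace (ideal_gen S)"
  by (rule cpoly.subspaceI) (simp_all add: ideal_gen_zero ideal_gen_add ideal_gen_cscale)

section \<open>Polynomial homomorphisms\<close>

text \<open>With \<open>c\<close> the identity this is evaluation at a point; with \<open>c\<close>
  equal to \<open>pconst\<close> it is substitution of polynomials for the variables.\<close>

definition mpoly_hom :: "(complex \<Rightarrow> 'b::comm_ring_1) \<Rightarrow> ('n::finite \<Rightarrow> 'b) \<Rightarrow> 'n mpoly \<Rightarrow> 'b" where
  "mpoly_hom c s p =
     (\<Sum>u\<in>Poly_Mapping.keys p. c (Poly_Mapping.lookup p u) *
        (\<Prod>j\<in>UNIV. s j ^ Poly_Mapping.lookup u j))"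

locale coeff_hom =
  fixes c :: "complex \<Rightarrow> 'b::comm_ring_1"
  assumes c_add: "c (x + y) = c x + c y"
    and c_mult: "c (x * y) = c x * c y"
    and c_one: "c 1 = 1"
begin

lemma c_zero: "c 0 = 0"
  using c_add[of 0 0] by simp

lemma hom_single:
  "mpoly_hom c s (Poly_Mapping.single u a) = c a * (\<Prod>j\<in>UNIV. s j ^ Poly_Mapping.lookup u j)"
  by (cases "a = 0") (simp_all add: mpoly_hom_def c_zero)

text \<open>Terms may cancel in \<open>p + q\<close>, so its key set can be smaller than the union
  of the two key sets. This is harmless because the summand is additive in the coefficient and
  vanishes at 0.\<close>

lemma hom_add: "mpoly_hom c s (p + q) = mpoly_hom c s p + mpoly_hom c s q"
  unfolding mpoly_hom_def
  by (rule setsum_keys_plus_distrib) (simp_all add: c_zero c_add ring_distribs)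

lemma hom_mult: "mpoly_hom c s (p * q) = mpoly_hom c s p * mpoly_hom c s q"
proof (induction p rule: poly_mapping_add_induct)
  case (single u a)
  show ?case
    by (induction q rule: poly_mapping_add_induct)
       (simp_all add: hom_single hom_add mult_single c_mult lookup_add power_add
          prod.distrib ring_distribs algebra_simps)
qed (simp add: hom_add ring_distribs)

lemma hom_zero: "mpoly_hom c s 0 = 0"
  by (simp add: mpoly_hom_def)

lemma hom_one: "mpoly_hom c s 1 = 1"
  using hom_single[of s 0 1] by (simp add: c_one)

lemma hom_uminus: "mpoly_hom c s (- p) = - mpoly_hom c s p"
  using hom_add[of s p "- p"] by (simp add: hom_zero add_eq_0_iff)

lemma hom_diff: "mpoly_hom c s (p - q) = mpoly_hom c s p - mpoly_hom c s q"
  using hom_add[of s p "- q"] by (simp add: hom_uminus)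

lemma hom_sum: "mpoly_hom c s (\<Sum>i\<in>S. f i) = (\<Sum>i\<in>S. mpoly_hom c s (f i))"
  by (induction S rule: infinite_finite_induct) (simp_all add: hom_zero hom_add)

lemma hom_prod: "mpoly_hom c s (\<Prod>i\<in>S. f i) = (\<Prod>i\<in>S. mpoly_hom c s (f i))"
  by (induction S rule: infinite_finite_induct) (simp_all add: hom_one hom_mult)

lemma hom_pconst: "mpoly_hom c s (pconst a) = c a"
  by (simp add: pconst_def hom_single)

lemma hom_pvar: "mpoly_hom c s (pvar j) = s j"
proof -
  have "(\<Prod>k\<in>UNIV. s k ^ Poly_Mapping.lookup (Poly_Mapping.single j 1) k)
      = (\<Prod>k\<in>UNIV. if k = j then s k else 1)"
    by (rule prod.cong) (auto simp: lookup_single when_def)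
  then show ?thesis
    by (simp add: pvar_def mon_def hom_single c_one)
qed

end

interpretation eval_hom: coeff_hom "\<lambda>x. x"
  by unfold_locales simp_all

lemma eval_mpoly_conv_hom: "eval_mpoly v = mpoly_hom (\<lambda>x. x) (\<lambda>j. v $ j)"
  by (simp add: fun_eq_iff eval_mpoly_def mpoly_hom_def)

interpretation subst_hom: coeff_hom pconst
  by unfold_locales (simp_all add: pconst_def single_add mult_single)

section \<open>Operators with polynomial symbols\<close>

lemma pderivative_single:
  "pderivative j (Poly_Mapping.single u c) =
     Poly_Mapping.single (u - Poly_Mapping.single j 1) (c * of_nat (Poly_Mapping.lookup u j))"
  by (cases "c = 0") (simp_all add: pderivative_def)

lemma pderivative_add: "pderivative j (f + g) = pderivative j f + pderivative j g"
  unfolding pderivative_def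
  by (rule setsum_keys_plus_distrib) (simp_all add: single_add ring_distribs)

lemma pderivative_zero: "pderivative j 0 = 0"
  by (simp add: pderivative_def)

lemma pderivative_commute: "pderivative j \<circ> pderivative k = pderivative k \<circ> pderivative j"
proof
  fix f
  show "(pderivative j \<circ> pderivative k) f = (pderivative k \<circ> pderivative j) f"
  proof (induction f rule: poly_mapping_add_induct)
    case (single u c)
    have "u - Poly_Mapping.single j (1::nat) - Poly_Mapping.single k 1
        = u - Poly_Mapping.single k 1 - Poly_Mapping.single j 1"
      by (rule poly_mapping_eqI) (simp add: lookup_minus)
    then show ?case
      by (cases "j = k") (simp_all add: pderivative_single lookup_minus lookup_single algebra_simps)
  qed (simp add: pderivative_add)
qed

lemma euler_op_single:
  "euler_op j (Poly_Mapping.single u c) =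
     Poly_Mapping.single u (c * of_nat (Poly_Mapping.lookup u j))"
proof (cases "Poly_Mapping.lookup u j = 0")
  case True
  then show ?thesis by (simp add: euler_op_def pderivative_single)
next
  case False
  then have "Poly_Mapping.single j (1::nat) + (u - Poly_Mapping.single j 1) = u"
    by (intro poly_mapping_eqI) (auto simp: lookup_add lookup_minus lookup_single when_def)
  then show ?thesis
    by (simp add: euler_op_def pderivative_single pvar_def mon_def mult_single)
qed

lemma euler_op_add: "euler_op j (f + g) = euler_op j f + euler_op j g"
  by (simp add: euler_op_def pderivative_add ring_distribs)

lemma euler_op_commute: "euler_op j \<circ> euler_op k = euler_op k \<circ> euler_op j"
proof
  fix f
  show "(euler_op j \<circ> euler_op k) f = (euler_op k \<circ> euler_op j) f"
    by (induction f rule: poly_mapping_add_induct)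
       (simp_all add: euler_op_single euler_op_add algebra_simps)
qed

text \<open>Treats derivatives and Euler operators together: commutation lets the fold in
  \<open>op_monomial\<close> peel off the variables in any order, and additivity reduces operator
  identities to single terms.\<close>

locale commuting_ops =
  fixes X :: "'n::finite \<Rightarrow> 'n mpoly \<Rightarrow> 'n mpoly"
  assumes add: "X j (f + g) = X j f + X j g"
    and commute: "X j \<circ> X k = X k \<circ> X j"
begin

lemma funpow_add: "(X j ^^ a) (f + g) = (X j ^^ a) f + (X j ^^ a) g"
  by (induction a) (simp_all add: add)

lemma funpow_commute: "(X j ^^ a) \<circ> (X k ^^ b) = (X k ^^ b) \<circ> (X j ^^ a)"
proof -
  have 1: "(X j ^^ a) (X k f) = X k ((X j ^^ a) f)" for a j k f
    using commute by (induction a) (simp_all add: fun_eq_iff)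
  have "(X j ^^ a) ((X k ^^ b) f) = (X k ^^ b) ((X j ^^ a) f)" for f
    by (induction b) (simp_all add: 1)
  then show ?thesis by (simp add: fun_eq_iff)
qed

text \<open>\<open>op_monomial\<close> folds over all variables at once; restricting the fold to a
  set \<open>S\<close> makes induction over the variables possible.\<close>

definition partial_op :: "'n expo \<Rightarrow> 'n set \<Rightarrow> 'n mpoly \<Rightarrow> 'n mpoly" where
  "partial_op e S = Finite_Set.fold (\<lambda>j F. (X j ^^ Poly_Mapping.lookup e j) \<circ> F) id S"

lemma partial_op_empty: "partial_op e {} = id"
  by (simp add: partial_op_def)

lemma partial_op_insert:
  assumes "j \<notin> S"
  shows "partial_op e (insert j S) = (X j ^^ Poly_Mapping.lookup e j) \<circ> partial_op e S"
proof -
  interpret comp_fun_commute "\<lambda>j F. (X j ^^ Poly_Mapping.lookup e j) \<circ> F"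
    using funpow_commute by unfold_locales (simp add: fun_eq_iff)
  show ?thesis
    unfolding partial_op_def using assms by (intro fold_insert) simp_all
qed

lemma op_monomial_add: "op_monomial X e (f + g) = op_monomial X e f + op_monomial X e g"
proof -
  have "partial_op e S (f + g) = partial_op e S f + partial_op e S g" for S
    by (induction S rule: finite_induct[OF finite])
       (simp_all add: partial_op_empty partial_op_insert funpow_add)
  then show ?thesis by (simp add: partial_op_def op_monomial_def)
qed

lemma op_subst_add_left: "op_subst X (p + q) f = op_subst X p f + op_subst X q f"
  unfolding op_subst_def
  by (rule setsum_keys_plus_distrib) (simp_all add: cpoly.scale_left_distrib)

lemma op_subst_add_right: "op_subst X p (f + g) = op_subst X p f + op_subst X p g"
  by (simp add: op_subst_def op_monomial_add cpoly.scale_right_distrib sum.distrib)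

lemma op_subst_single: "op_subst X (Poly_Mapping.single e a) f = cscale a (op_monomial X e f)"
  by (cases "a = 0") (simp_all add: op_subst_def)

text \<open>Here \<open>\<delta> k\<close> is the amount by which the \<open>k\<close>-th power of
  an operator lowers the exponent and \<open>h\<close> is the scalar it produces: \<open>k\<close>
  and a falling factorial for derivatives, 0 and a power for Euler operators.\<close>

lemma op_monomial_single:
  assumes step: "\<And>j k u c. (X j ^^ k) (Poly_Mapping.single u c) =
      Poly_Mapping.single (u - Poly_Mapping.single j (\<delta> k)) (c * h (Poly_Mapping.lookup u j) k)"
  shows "op_monomial X e (Poly_Mapping.single u c) =
      Poly_Mapping.single (u - (\<Sum>j\<in>UNIV. Poly_Mapping.single j (\<delta> (Poly_Mapping.lookup e j))))
        (c * (\<Prod>j\<in>UNIV. h (Poly_Mapping.lookup u j) (Poly_Mapping.lookup e j)))"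
proof -
  have "partial_op e S (Poly_Mapping.single u c) =
      Poly_Mapping.single (u - (\<Sum>j\<in>S. Poly_Mapping.single j (\<delta> (Poly_Mapping.lookup e j))))
        (c * (\<Prod>j\<in>S. h (Poly_Mapping.lookup u j) (Poly_Mapping.lookup e j)))" for S
  proof (induction S rule: finite_induct[OF finite])
    case (2 j S)
    let ?t = "\<Sum>j\<in>S. Poly_Mapping.single j (\<delta> (Poly_Mapping.lookup e j))"
    \<comment> \<open>The operator of \<open>j\<close> has not acted yet, so the exponent of
      \<open>j\<close> is still the one in \<open>u\<close>.\<close>
    have "Poly_Mapping.lookup ?t j = (\<Sum>i\<in>S. 0)"
      unfolding lookup_sum using 2 by (intro sum.cong) (auto simp: lookup_single when_def)
    then have "Poly_Mapping.lookup (u - ?t) j = Poly_Mapping.lookup u j"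
      by (simp add: lookup_minus)
    moreover have "u - ?t - Poly_Mapping.single j r = u - (Poly_Mapping.single j r + ?t)" for r
      by (simp add: diff_diff_add add.commute)
    ultimately show ?case
      using 2 by (simp add: partial_op_insert step algebra_simps)
  qed (simp add: partial_op_empty)
  then show ?thesis by (simp add: partial_op_def op_monomial_def)
qed

end

interpretation pderiv: commuting_ops pderivative
  by unfold_locales (rule pderivative_add pderivative_commute)+

interpretation euler: commuting_ops euler_op
  by unfold_locales (rule euler_op_add euler_op_commute)+

section \<open>Falling factorials, and monomial operators as polynomials in the Euler
  operators\<close>

definition falling :: "complex \<Rightarrow> nat \<Rightarrow> complex" where
  "falling z k = (\<Prod>i<k. z - of_nat i)"

lemma falling_nat_eq_0: "a < k \<Longrightarrow> falling (of_nat a) k = 0"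
  by (auto simp: falling_def)

text \<open>The induction generalises \<open>a\<close> because the last factor of the falling
  factorial, \<open>a + 1\<close>, is absorbed into \<open>fact a\<close>.\<close>

lemma falling_nat_fact: "falling (of_nat (a + k)) k * fact a = fact (a + k)"
proof (induction k arbitrary: a)
  case (Suc k)
  have "falling (of_nat (a + Suc k)) (Suc k) * fact a
      = falling (of_nat (Suc a + k)) k * fact (Suc a)"
    by (simp add: falling_def algebra_simps)
  also have "\<dots> = fact (a + Suc k)" using Suc[of "Suc a"] by simp
  finally show ?case .
qed (simp add: falling_def)

lemma op_monomial_pderivative_single:
  "op_monomial pderivative e (Poly_Mapping.single u c) =
     Poly_Mapping.single (u - e)
       (c * (\<Prod>j\<in>UNIV. falling (of_nat (Poly_Mapping.lookup u j)) (Poly_Mapping.lookup e j)))"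
proof -
  have "(pderivative j ^^ k) (Poly_Mapping.single u c) =
      Poly_Mapping.single (u - Poly_Mapping.single j k) (c * falling (of_nat (Poly_Mapping.lookup u j)) k)"
    for j k u c
  proof (induction k)
    case (Suc k)
    have eq: "u - Poly_Mapping.single j k - Poly_Mapping.single j 1 = u - Poly_Mapping.single j (Suc k)"
      by (simp add: diff_diff_add flip: single_add)
    \<comment> \<open>Exponent subtraction truncates at 0. For \<open>k\<close> beyond the exponent
      both sides are zero anyway, since the falling factorial already contains the factor 0.\<close>
    show ?case
    proof (cases "k \<le> Poly_Mapping.lookup u j")
      case True
      then show ?thesis
        by (simp add: Suc pderivative_single eq[simplified] lookup_minus of_nat_diff falling_def
            mult.assoc)
    next
      case False
      then show ?thesis
        by (simp add: Suc pderivative_zero falling_nat_eq_0)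
    qed
  qed (simp add: falling_def)
  from pderiv.op_monomial_single[of "\<lambda>k. k" "\<lambda>a. falling (of_nat a)", OF this]
  show ?thesis by (simp add: sum_single_lookup)
qed

text \<open>Monomials are common eigenvectors of the Euler operators, with the exponents as
  eigenvalues, so a polynomial in these operators acts by its value at the exponent vector.\<close>

lemma op_subst_euler_single:
  "op_subst euler_op p (Poly_Mapping.single u c) =
     Poly_Mapping.single u (c * eval_mpoly (\<chi> j. of_nat (Poly_Mapping.lookup u j)) p)"
proof (induction p rule: poly_mapping_add_induct)
  case (single e a)
  have "(euler_op j ^^ k) (Poly_Mapping.single u c) =
      Poly_Mapping.single (u - Poly_Mapping.single j 0) (c * of_nat (Poly_Mapping.lookup u j) ^ k)"
    for j k u c
    by (induction k) (simp_all add: euler_op_single mult_ac)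
  note eq = euler.op_monomial_single[of "\<lambda>k. 0" "\<lambda>a k. of_nat a ^ k", OF this]
  show ?case
    by (simp add: eq euler.op_subst_single eval_mpoly_conv_hom eval_hom.hom_single cscale_single
        algebra_simps)
qed (simp add: euler.op_subst_add_left eval_mpoly_conv_hom eval_hom.hom_add ring_distribs single_add)

definition falling_poly :: "'n::finite expo \<Rightarrow> 'n mpoly" where
  "falling_poly e = (\<Prod>j\<in>UNIV. \<Prod>k<Poly_Mapping.lookup e j. pvar j - pconst (of_nat k))"

lemma eval_falling_poly:
  "eval_mpoly v (falling_poly e) = (\<Prod>j\<in>UNIV. falling (v $ j) (Poly_Mapping.lookup e j))"
  by (simp add: falling_poly_def falling_def eval_mpoly_conv_hom eval_hom.hom_prod eval_hom.hom_diff
      eval_hom.hom_pconst eval_hom.hom_pvar)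

text \<open>The classical identity between x^e d^e and a product of falling factorials in the Euler
  operators. On a monomial that x^e does not divide, both sides vanish.\<close>

lemma op_subst_falling_poly:
  "op_subst euler_op (falling_poly e) f = mon e * op_subst pderivative (mon e) f"
proof (induction f rule: poly_mapping_add_induct)
  case (single u c)
  show ?case
  proof (cases "\<forall>j. Poly_Mapping.lookup e j \<le> Poly_Mapping.lookup u j")
    case True
    then have "e + (u - e) = u"
      by (intro poly_mapping_eqI) (simp add: lookup_add lookup_minus)
    then show ?thesis
      by (simp add: op_subst_euler_single eval_falling_poly mon_def pderiv.op_subst_single
          op_monomial_pderivative_single mult_single)
  next
    case False
    then have eq: "(\<Prod>j\<in>UNIV. falling (of_nat (Poly_Mapping.lookup u j)) (Poly_Mapping.lookup e j)) = 0"
      by (intro prod_zero) (auto intro: falling_nat_eq_0 simp: not_le)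
    show ?thesis
      by (simp del: prod_zero_iff add: op_subst_euler_single eval_falling_poly mon_def
          pderiv.op_subst_single op_monomial_pderivative_single eq)
  qed
qed (simp add: euler.op_subst_add_right pderiv.op_subst_add_right ring_distribs)

lemma mult_mon_in_weyl_algebra: "(\<lambda>f. mon u * f) \<in> weyl_algebra"
  for u :: "'n::finite expo"
proof -
  have "cscale 1 = (\<lambda>f :: 'n mpoly. 1 * f)"
    by (simp add: fun_eq_iff)
  then have one: "(\<lambda>f :: 'n mpoly. 1 * f) \<in> weyl_algebra"
    using weyl_algebra.const[of 1] by metis
  have mult: "(\<lambda>f. (p * q) * f) \<in> weyl_algebra"
    if "(\<lambda>f. p * f) \<in> weyl_algebra" "(\<lambda>f. q * f) \<in> weyl_algebra" for p q :: "'n mpoly"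
    using weyl_algebra.mult[OF that] by (simp add: o_def mult.assoc)
  have pow: "(\<lambda>f. mon (Poly_Mapping.single j k) * f) \<in> weyl_algebra" for j :: 'n and k
  proof (induction k)
    case (Suc k)
    have eq: "mon (Poly_Mapping.single j (Suc k)) = pvar j * mon (Poly_Mapping.single j k)"
      by (simp add: pvar_def mon_mult flip: single_add)
    show ?case unfolding eq by (rule mult[OF weyl_algebra.var Suc])
  qed (use one in simp)
  have "(\<lambda>f. (\<Prod>j\<in>S. mon (Poly_Mapping.single j (Poly_Mapping.lookup u j))) * f) \<in> weyl_algebra" for S
  proof (induction S rule: finite_induct[OF finite])
    case (2 j S)
    then show ?case using mult[OF pow] by simp
  qed (use one in simp)
  then show ?thesis
    using sum_single_lookup[of u] mon_sum by metis
qed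

text \<open>The operator x^e d^e is a left multiple of d^e, hence a one-summand element of the left
  ideal; the Euler part of the ideal contributes 0.\<close>

lemma falling_poly_in_fake_indicial_ideal:
  assumes "mon e \<in> initial_ideal w (toric_ideal A)"
  shows "falling_poly e \<in> fake_indicial_ideal A \<beta> w"
proof -
  let ?S = "op_subst pderivative ` initial_ideal w (toric_ideal A)"
  have "op_subst euler_op (falling_poly e) =
      (\<lambda>f. \<Sum>i<(1::nat). (\<lambda>f. mon e * f) (op_subst pderivative (mon e) f))"
    by (simp add: fun_eq_iff op_subst_falling_poly)
  then have "op_subst euler_op (falling_poly e) \<in> weyl_left_ideal ?S"
    unfolding weyl_left_ideal_def using mult_mon_in_weyl_algebra[of e] assms
    by (intro CollectI exI[of _ "1::nat"] exI[of _ "\<lambda>_ f. mon e * f"]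
        exI[of _ "\<lambda>_. op_subst pderivative (mon e)"]) simp
  then show ?thesis
    unfolding fake_indicial_ideal_def ideal_sum_def using ideal_gen_zero
    by (intro CollectI exI[of _ "falling_poly e"] exI[of _ 0]) simp
qed

section \<open>Homogeneous components\<close>

lemma expo_degree_add: "expo_degree (u + u') = expo_degree u + expo_degree u'"
  by (simp add: expo_degree_def lookup_add sum.distrib)

lemma lookup_le_expo_degree: "Poly_Mapping.lookup u j \<le> expo_degree u"
  unfolding expo_degree_def by (rule member_le_sum) simp_all

lemma expo_degree_single: "expo_degree (Poly_Mapping.single j k) = k"
  by (simp add: expo_degree_def lookup_single when_def)

text \<open>Each exponent is bounded by the degree, so these vectors embed into a finite function
  space.\<close>

lemma finite_expo_degree: "finite {u :: 'n::finite expo. expo_degree u = q}"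
proof (rule finite_imageD[where f = Poly_Mapping.lookup])
  have "Poly_Mapping.lookup ` {u :: 'n expo. expo_degree u = q} \<subseteq> {f. \<forall>j. f j \<in> {..q}}"
  proof
    fix f assume "f \<in> Poly_Mapping.lookup ` {u :: 'n expo. expo_degree u = q}"
    then obtain u :: "'n expo" where "expo_degree u = q" "f = Poly_Mapping.lookup u" by blast
    then show "f \<in> {f. \<forall>j. f j \<in> {..q}}" using lookup_le_expo_degree[of u] by simp
  qed
  moreover have "finite {f :: 'n \<Rightarrow> nat. \<forall>j. f j \<in> {..q}}"
    using finite_PiE[of "UNIV :: 'n set" "\<lambda>_. {..q}"] by (simp add: PiE_UNIV_domain Pi_def)
  ultimately show "finite (Poly_Mapping.lookup ` {u :: 'n expo. expo_degree u = q})"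
    by (rule finite_subset)
  show "inj_on Poly_Mapping.lookup {u :: 'n expo. expo_degree u = q}"
    by (rule inj_onI) (simp add: lookup_inject)
qed

lemma subspace_homogeneous_part: "cpoly.subspace (homogeneous_part q)"
proof (rule cpoly.subspaceI)
  fix p r :: "'n::finite mpoly" and c
  assume "p \<in> homogeneous_part q"
  then show "cscale c p \<in> homogeneous_part q"
    by (auto simp: homogeneous_part_def in_keys_iff lookup_cscale)
  assume "r \<in> homogeneous_part q"
  with \<open>p \<in> homogeneous_part q\<close> show "p + r \<in> homogeneous_part q"
    using keys_add[of p r] by (auto simp: homogeneous_part_def)
qed (simp add: homogeneous_part_def)

lemma homogeneous_part_mult:
  "p \<in> homogeneous_part a \<Longrightarrow> r \<in> homogeneous_part b \<Longrightarrow> p * r \<in> homogeneous_part (a + b)"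
  using keys_mult[of p r] by (fastforce simp: homogeneous_part_def expo_degree_add)

lemma mon_homogeneous: "mon u \<in> homogeneous_part (expo_degree u)"
  by (simp add: homogeneous_part_def)

definition hcomp :: "nat \<Rightarrow> 'n::finite mpoly \<Rightarrow> 'n mpoly" where
  "hcomp q p = (\<Sum>u\<in>{u \<in> Poly_Mapping.keys p. expo_degree u = q}.
     Poly_Mapping.single u (Poly_Mapping.lookup p u))"

lemma lookup_hcomp:
  "Poly_Mapping.lookup (hcomp q p) u = (if expo_degree u = q then Poly_Mapping.lookup p u else 0)"
  by (auto simp: hcomp_def lookup_sum lookup_single when_def in_keys_iff)

lemma hcomp_homogeneous: "hcomp q p \<in> homogeneous_part q"
  by (auto simp: homogeneous_part_def in_keys_iff lookup_hcomp split: if_splits)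

lemma hcomp_of_homogeneous:
  "p \<in> homogeneous_part d \<Longrightarrow> hcomp q p = (if d = q then p else 0)"
  by (rule poly_mapping_eqI) (auto simp: lookup_hcomp homogeneous_part_def in_keys_iff)

lemma hcomp_add: "hcomp q (p + r) = hcomp q p + hcomp q r"
  by (rule poly_mapping_eqI) (simp add: lookup_hcomp lookup_add)

lemma hcomp_zero: "hcomp q 0 = 0"
  by (rule poly_mapping_eqI) (simp add: lookup_hcomp)

lemma hcomp_sum: "hcomp q (\<Sum>i\<in>I. f i) = (\<Sum>i\<in>I. hcomp q (f i))"
  by (induction I rule: infinite_finite_induct) (simp_all add: hcomp_zero hcomp_add)

text \<open>An ideal with homogeneous generators is graded: a term times a homogeneous generator is
  homogeneous, so its component in degree \<open>q\<close> is either itself or 0.\<close>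

lemma hcomp_ideal_gen:
  assumes hom: "\<And>s. s \<in> S \<Longrightarrow> \<exists>d. s \<in> homogeneous_part d" and p: "p \<in> ideal_gen S"
  shows "hcomp q p \<in> ideal_gen S"
  using p
proof (induction rule: ideal_gen_induct)
  case (step r s p)
  obtain d where d: "s \<in> homogeneous_part d" using hom[OF step(1)] by blast
  have "hcomp q (r * s) \<in> ideal_gen S"
  proof (induction r rule: poly_mapping_add_induct)
    case (single u c)
    have "Poly_Mapping.single u c \<in> homogeneous_part (expo_degree u)"
      by (simp add: homogeneous_part_def)
    from homogeneous_part_mult[OF this d] show ?case
      using step(1) by (simp add: hcomp_of_homogeneous ideal_gen_zero ideal_gen_mult ideal_gen_base)
  qed (simp add: ring_distribs hcomp_add ideal_gen_add)
  then show ?case using step by (simp add: hcomp_add ideal_gen_add)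
qed (simp add: hcomp_zero ideal_gen_zero)

section \<open>The apolarity pairing\<close>

definition expo_fact :: "'n::finite expo \<Rightarrow> complex" where
  "expo_fact u = (\<Prod>j\<in>UNIV. fact (Poly_Mapping.lookup u j))"

lemma expo_fact_nonzero: "expo_fact u \<noteq> 0"
  by (simp add: expo_fact_def)

text \<open>The constant term of \<phi>(d) f in coordinates: distinct monomials are orthogonal, and
  a monomial pairs with itself to the multi-index factorial.\<close>

definition mpair :: "'n::finite mpoly \<Rightarrow> 'n mpoly \<Rightarrow> complex" where
  "mpair \<phi> f = (\<Sum>u\<in>Poly_Mapping.keys f. Poly_Mapping.lookup \<phi> u * Poly_Mapping.lookup f u * expo_fact u)"

lemma mpair_add_right: "mpair \<phi> (f + g) = mpair \<phi> f + mpair \<phi> g"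
  unfolding mpair_def by (rule setsum_keys_plus_distrib) (simp_all add: ring_distribs)

lemma mpair_add_left: "mpair (\<phi> + \<psi>) f = mpair \<phi> f + mpair \<psi> f"
  by (simp add: mpair_def lookup_add ring_distribs sum.distrib)

lemma mpair_cscale_left: "mpair (cscale c \<phi>) f = c * mpair \<phi> f"
  by (simp add: mpair_def lookup_cscale sum_distrib_left mult.assoc)

lemma mpair_single_right:
  "mpair \<phi> (Poly_Mapping.single u c) = Poly_Mapping.lookup \<phi> u * c * expo_fact u"
  by (cases "c = 0") (simp_all add: mpair_def)

lemma mpair_cscale_right: "mpair \<phi> (cscale c f) = c * mpair \<phi> f"
  by (induction f rule: poly_mapping_add_induct)
     (simp_all add: cscale_single mpair_single_right mpair_add_right cpoly.scale_right_distrib ring_distribs)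

lemma mpair_zero_left: "mpair 0 f = 0"
  by (simp add: mpair_def)

lemma mpair_zero_right: "mpair \<phi> 0 = 0"
  by (simp add: mpair_def)

lemma mpair_uminus_right: "mpair \<phi> (- f) = - mpair \<phi> f"
  using mpair_add_right[of \<phi> f "- f"] by (simp add: mpair_zero_right add_eq_0_iff)

lemma mpair_diff_right: "mpair \<phi> (f - g) = mpair \<phi> f - mpair \<phi> g"
  using mpair_add_right[of \<phi> f "- g"] by (simp add: mpair_uminus_right)

lemma mpair_sum_left: "mpair (\<Sum>i\<in>I. \<phi> i) f = (\<Sum>i\<in>I. mpair (\<phi> i) f)"
  by (induction I rule: infinite_finite_induct) (simp_all add: mpair_add_left mpair_zero_left)

lemma mpair_sum_right: "mpair \<phi> (\<Sum>i\<in>I. f i) = (\<Sum>i\<in>I. mpair \<phi> (f i))"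
  by (induction I rule: infinite_finite_induct) (simp_all add: mpair_add_right mpair_zero_right)

lemma mpair_mon_left: "mpair (mon u) f = Poly_Mapping.lookup f u * expo_fact u"
  by (induction f rule: poly_mapping_add_induct)
     (simp_all add: mpair_single_right mpair_add_right lookup_add lookup_mon lookup_single ring_distribs)

lemma mpair_hcomp: "mpair \<phi> (hcomp q f) = mpair (hcomp q \<phi>) f"
proof -
  have "mpair \<phi> (hcomp q f) = (\<Sum>u\<in>Poly_Mapping.keys f. Poly_Mapping.lookup \<phi> u
      * Poly_Mapping.lookup (hcomp q f) u * expo_fact u)"
    unfolding mpair_def
    by (rule sum.mono_neutral_left) (auto simp: in_keys_iff lookup_hcomp split: if_splits)
  also have "\<dots> = mpair (hcomp q \<phi>) f"
    unfolding mpair_def by (rule sum.cong) (simp_all add: lookup_hcomp)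
  finally show ?thesis .
qed

text \<open>Taylor's formula: the coefficient at \<open>t\<close>, times the factorial of
  \<open>t\<close>, is the constant term after applying d^t, and d^t composed with \<phi>(d) has
  symbol \<open>mon t * \<phi>\<close>.\<close>

lemma lookup_op_subst_pderivative:
  "Poly_Mapping.lookup (op_subst pderivative \<phi> f) t * expo_fact t = mpair (mon t * \<phi>) f"
proof (induction \<phi> rule: poly_mapping_add_induct)
  case (single e a)
  show ?case
  proof (induction f rule: poly_mapping_add_induct)
    case (single u c)
    let ?F = "\<Prod>j\<in>UNIV. falling (of_nat (Poly_Mapping.lookup u j)) (Poly_Mapping.lookup e j)"
    have lhs: "Poly_Mapping.lookup (op_subst pderivative (Poly_Mapping.single e a) (Poly_Mapping.single u c)) t
        = (if u - e = t then a * (c * ?F) else 0)"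
      by (simp add: pderiv.op_subst_single op_monomial_pderivative_single cscale_single lookup_single
          when_def)
    have rhs: "mpair (mon t * Poly_Mapping.single e a) (Poly_Mapping.single u c)
        = (if u = t + e then a * c * expo_fact u else 0)"
      by (simp add: mpair_single_right mon_def mult_single lookup_single when_def)
    show ?case
    proof (cases "u = t + e")
      case True
      have "?F * expo_fact t = (\<Prod>j\<in>UNIV. falling (of_nat (Poly_Mapping.lookup t j +
          Poly_Mapping.lookup e j)) (Poly_Mapping.lookup e j) * fact (Poly_Mapping.lookup t j))"
        unfolding expo_fact_def True prod.distrib lookup_add ..
      also have "\<dots> = expo_fact u"
        unfolding expo_fact_def True lookup_add falling_nat_fact ..
      finally have eq: "?F * expo_fact t = expo_fact u" .
      have "u - e = t" using True by simp
      then show ?thesis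
        unfolding lhs rhs by (simp only: if_True True[symmetric] refl mult.assoc eq)
    next
      case False
      \<comment> \<open>Truncated subtraction can yield \<open>t\<close> although \<open>u\<close>
        differs from \<open>t + e\<close>; then \<open>e\<close> exceeds \<open>u\<close> in some
        variable and the falling factorial there is 0.\<close>
      have "?F = 0" if "u - e = t"
      proof -
        have "\<exists>j. Poly_Mapping.lookup u j < Poly_Mapping.lookup e j"
        proof (rule ccontr)
          assume "\<nexists>j. Poly_Mapping.lookup u j < Poly_Mapping.lookup e j"
          then have "u = t + e"
            using that by (intro poly_mapping_eqI) (auto simp: lookup_add lookup_minus not_less)
          with False show False ..
        qed
        then show ?thesis
          by (intro prod_zero) (auto intro: falling_nat_eq_0)
      qed
      then show ?thesis unfolding lhs rhs using False by simp
    qed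
  qed (simp add: pderiv.op_subst_add_right lookup_add mpair_add_right ring_distribs)
qed (simp add: pderiv.op_subst_add_left lookup_add mpair_add_left ring_distribs)

text \<open>An ideal absorbs monomials, so vanishing of the constant terms for all its members
  already forces every coefficient of \<phi>(d) f to vanish.\<close>

lemma perp_ideal_gen_iff: "f \<in> perp (ideal_gen S) \<longleftrightarrow> (\<forall>\<phi>\<in>ideal_gen S. mpair \<phi> f = 0)"
proof
  assume f: "f \<in> perp (ideal_gen S)"
  show "\<forall>\<phi>\<in>ideal_gen S. mpair \<phi> f = 0"
  proof
    fix \<phi> assume "\<phi> \<in> ideal_gen S"
    then have "op_subst pderivative \<phi> f = 0" using f by (simp add: perp_def)
    then show "mpair \<phi> f = 0"
      using lookup_op_subst_pderivative[of \<phi> f 0] by simp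
  qed
next
  assume *: "\<forall>\<phi>\<in>ideal_gen S. mpair \<phi> f = 0"
  have "op_subst pderivative \<phi> f = 0" if "\<phi> \<in> ideal_gen S" for \<phi>
  proof (rule poly_mapping_eqI)
    fix t
    have "mpair (mon t * \<phi>) f = 0" using * ideal_gen_mult[OF that] by blast
    then show "Poly_Mapping.lookup (op_subst pderivative \<phi> f) t = Poly_Mapping.lookup 0 t"
      using lookup_op_subst_pderivative[of \<phi> f t] expo_fact_nonzero[of t] by simp
  qed
  then show "f \<in> perp (ideal_gen S)" by (simp add: perp_def)
qed

section \<open>Bases of quotient spaces\<close>

definition quot_basis :: "'n mpoly set \<Rightarrow> 'n mpoly set \<Rightarrow> 'n mpoly set \<Rightarrow> bool" where
  "quot_basis W U B \<longleftrightarrow> finite B \<and> B \<subseteq> W \<and>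
     (\<forall>p\<in>W. \<exists>!c. (\<forall>b. b \<notin> B \<longrightarrow> c b = 0) \<and> p - (\<Sum>b\<in>B. cscale (c b) b) \<in> U)"

text \<open>\<open>quot_dim\<close> is a definite description, so besides a basis one needs that all
  bases have the same size; the second premise lets the duality with the apolar space supply
  this.\<close>

lemma quot_dim_eqI:
  assumes "quot_basis W U B" and "\<And>B. quot_basis W U B \<Longrightarrow> card B = n"
  shows "quot_dim W U = n"
proof -
  have "quot_dim W U = (THE n. \<exists>B. quot_basis W U B \<and> card B = n)"
    unfolding quot_dim_def quot_basis_def by (rule arg_cong[where f = The]) (auto simp: fun_eq_iff)
  also have "\<dots> = n"
    using assms by (intro the_equality) auto
  finally show ?thesis .
qed

text \<open>Among the subsets of \<open>F\<close> that span \<open>W\<close> modulo \<open>U\<close>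
  one of least size is taken; a nontrivial relation modulo \<open>U\<close> would allow dropping an
  element.\<close>

lemma quot_basis_exists:
  assumes F: "finite F" "F \<subseteq> W" "W \<subseteq> cpoly.span F" and U: "cpoly.subspace U"
  shows "\<exists>B. quot_basis W U B"
proof -
  define spans where "spans B \<longleftrightarrow> B \<subseteq> F \<and> (\<forall>p\<in>W. \<exists>c. p - (\<Sum>b\<in>B. cscale (c b) b) \<in> U)" for B
  have "spans F"
    unfolding spans_def
  proof (intro conjI ballI)
    fix p assume "p \<in> W"
    then obtain c where "p = (\<Sum>b\<in>F. cscale (c b) b)"
      using F cpoly.span_finite[OF F(1)] by blast
    then show "\<exists>c. p - (\<Sum>b\<in>F. cscale (c b) b) \<in> U"
      using cpoly.subspace_0[OF U] by (intro exI[of _ c]) simp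
  qed simp
  then obtain B where B: "spans B" and min: "\<And>B'. spans B' \<Longrightarrow> card B \<le> card B'"
    using ex_has_least_nat[of spans F card] by blast
  have finB: "finite B" using B F(1) finite_subset unfolding spans_def by blast
  have indep: "d b = 0" if d: "(\<Sum>b\<in>B. cscale (d b) b) \<in> U" and b: "b \<in> B" for d b
  proof (rule ccontr)
    assume nz: "d b \<noteq> 0"
    have "spans (B - {b})"
      unfolding spans_def
    proof (intro conjI ballI)
      fix p assume "p \<in> W"
      then obtain c where c: "p - (\<Sum>b\<in>B. cscale (c b) b) \<in> U"
        using B unfolding spans_def by blast
      \<comment> \<open>The multiple of the relation \<open>d\<close> is chosen so that the
        coefficient at \<open>b\<close> becomes 0.\<close>
      define e where "e b' = c b' - c b / d b * d b'" for b'
      have "p - (\<Sum>b'\<in>B - {b}. cscale (e b') b') = p - (\<Sum>b'\<in>B. cscale (e b') b')"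
        using nz finB b by (simp add: sum.remove[of B b] e_def)
      also have "\<dots> = p - (\<Sum>b\<in>B. cscale (c b) b) + cscale (c b / d b) (\<Sum>b\<in>B. cscale (d b) b)"
        by (simp add: e_def cpoly.scale_left_diff_distrib sum_subtractf cpoly.scale_sum_right)
      also have "\<dots> \<in> U"
        using c d U by (simp add: cpoly.subspace_add cpoly.subspace_scale)
      finally show "\<exists>c. p - (\<Sum>b'\<in>B - {b}. cscale (c b') b') \<in> U" by blast
    qed (use B in \<open>auto simp: spans_def\<close>)
    from min[OF this] show False
      using card_Diff1_less[OF finB b] by simp
  qed
  have "quot_basis W U B"
    unfolding quot_basis_def
  proof (intro conjI ballI)
    show "B \<subseteq> W" using B F(2) by (auto simp: spans_def)
    fix p assume "p \<in> W"
    then obtain c where c: "p - (\<Sum>b\<in>B. cscale (c b) b) \<in> U"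
      using B unfolding spans_def by blast
    \<comment> \<open>Uniqueness is asked among coefficient functions vanishing off
      \<open>B\<close>, so the witness is set to 0 there.\<close>
    show "\<exists>!c. (\<forall>b. b \<notin> B \<longrightarrow> c b = 0) \<and> p - (\<Sum>b\<in>B. cscale (c b) b) \<in> U"
    proof (rule ex1I[of _ "\<lambda>b. if b \<in> B then c b else 0"])
      show "(\<forall>b. b \<notin> B \<longrightarrow> (if b \<in> B then c b else 0) = 0) \<and>
          p - (\<Sum>b\<in>B. cscale (if b \<in> B then c b else 0) b) \<in> U"
        using c by simp
      fix c' assume c': "(\<forall>b. b \<notin> B \<longrightarrow> c' b = 0) \<and> p - (\<Sum>b\<in>B. cscale (c' b) b) \<in> U"
      have "(\<Sum>b\<in>B. cscale (c b - c' b) b)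
          = (p - (\<Sum>b\<in>B. cscale (c' b) b)) - (p - (\<Sum>b\<in>B. cscale (c b) b))"
        by (simp add: cpoly.scale_left_diff_distrib sum_subtractf)
      also have "\<dots> \<in> U" using c c' by (intro cpoly.subspace_diff[OF U _ c]) simp
      finally have "c b - c' b = 0" if "b \<in> B" for b
        using indep[of "\<lambda>b. c b - c' b", OF _ that] by simp
      then show "c' = (\<lambda>b. if b \<in> B then c b else 0)"
        using c' by (auto simp: fun_eq_iff)
    qed
  qed (rule finB)
  then show ?thesis ..
qed

text \<open>The elements of \<open>Q\<^sup>\<bottom>\<close> dual to a basis of the quotient form a basis themselves.\<close>

lemma dim_perp_homogeneous:
  fixes S :: "'n::finite mpoly set"
  defines "Q \<equiv> ideal_gen S"
  assumes hom: "\<And>s. s \<in> S \<Longrightarrow> \<exists>d. s \<in> homogeneous_part d"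
    and W: "W \<subseteq> homogeneous_part q" "cpoly.subspace W"
    and reduce: "\<And>p. p \<in> homogeneous_part q \<Longrightarrow> \<exists>p'\<in>W. p - p' \<in> Q"
    and WU: "\<And>p. p \<in> W \<Longrightarrow> p \<in> U \<longleftrightarrow> p \<in> Q"
    and B: "quot_basis W U B"
  shows "cpoly.dim (perp Q \<inter> homogeneous_part q) = card B"
proof -
  have finB: "finite B" and BW: "B \<subseteq> W"
    and ex1: "\<And>p. p \<in> W \<Longrightarrow> \<exists>!c. (\<forall>b. b \<notin> B \<longrightarrow> c b = 0) \<and> p - (\<Sum>b\<in>B. cscale (c b) b) \<in> U"
    using B by (auto simp: quot_basis_def)
  have subQ: "cpoly.subspace Q" unfolding Q_def by (rule subspace_ideal_gen)
  have combW: "(\<Sum>b\<in>B. cscale (c b) b) \<in> W" for c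
    using W BW by (intro cpoly.subspace_sum cpoly.subspace_scale) auto
  have indep: "c b = 0" if c: "(\<Sum>b\<in>B. cscale (c b) b) \<in> Q" and b: "b \<in> B" for c b
  proof -
    let ?c = "\<lambda>b. if b \<in> B then c b else 0"
    have "- (\<Sum>b\<in>B. cscale (c b) b) \<in> W" "- (\<Sum>b\<in>B. cscale (c b) b) \<in> Q"
      using combW c W(2) subQ by (auto intro: cpoly.subspace_neg)
    then have "0 - (\<Sum>b\<in>B. cscale (?c b) b) \<in> U"
      by (simp add: WU)
    moreover have "0 - (\<Sum>b\<in>B. cscale 0 b) \<in> U"
      using W(2) subQ by (simp add: WU cpoly.subspace_0)
    ultimately have "?c = (\<lambda>b. 0)"
      using ex1[OF cpoly.subspace_0[OF W(2)]] by auto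
    then show ?thesis using b by (metis (full_types))
  qed
  have "\<exists>c. mon u - (\<Sum>b\<in>B. cscale (c b) b) \<in> Q" if "expo_degree u = q" for u
  proof -
    have "mon u \<in> homogeneous_part q" using mon_homogeneous[of u] that by simp
    then obtain p' where p': "p' \<in> W" "mon u - p' \<in> Q" using reduce by blast
    obtain c where "p' - (\<Sum>b\<in>B. cscale (c b) b) \<in> U" using ex1[OF p'(1)] by blast
    then have "p' - (\<Sum>b\<in>B. cscale (c b) b) \<in> Q"
      using WU p'(1) combW W(2) by (simp add: cpoly.subspace_diff)
    from cpoly.subspace_add[OF subQ p'(2) this] show ?thesis by auto
  qed
  then obtain \<gamma> where \<gamma>: "\<And>u. expo_degree u = q \<Longrightarrow> mon u - (\<Sum>b\<in>B. cscale (\<gamma> u b) b) \<in> Q"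
    by metis
  define E where "E = {u :: 'n expo. expo_degree u = q}"
  have finE: "finite E" unfolding E_def by (rule finite_expo_degree)
  \<comment> \<open>The coordinate at \<open>b\<close> of the degree-\<open>q\<close> part of \<phi>
    modulo \<open>Q\<close>, extended linearly from the coordinates \<open>\<gamma>\<close> of the
    monomials.\<close>
  define lam where "lam \<phi> b = (\<Sum>u\<in>E. Poly_Mapping.lookup \<phi> u * \<gamma> u b)" for \<phi> b
  \<comment> \<open>The polynomial representing the functional \<open>lam _ b\<close> under the
    pairing; dividing by \<open>expo_fact u\<close> cancels the weight of the pairing.\<close>
  define g where "g b = (\<Sum>u\<in>E. Poly_Mapping.single u (\<gamma> u b / expo_fact u))" for b
  have mpair_g: "mpair \<phi> (g b) = lam \<phi> b" for \<phi> b
    by (simp add: g_def lam_def mpair_sum_right mpair_single_right expo_fact_nonzero)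
  have lam_mod_Q: "\<phi> - (\<Sum>b\<in>B. cscale (lam \<phi> b) b) \<in> Q" if "\<phi> \<in> homogeneous_part q" for \<phi>
  proof -
    have "\<phi> = (\<Sum>u\<in>E. cscale (Poly_Mapping.lookup \<phi> u) (mon u))"
      using that finE
      by (intro poly_mapping_eqI)
         (auto simp: lookup_sum lookup_cscale lookup_mon homogeneous_part_def E_def in_keys_iff
            if_distrib sum.delta' cong: if_cong)
    moreover have "(\<Sum>b\<in>B. cscale (lam \<phi> b) b)
        = (\<Sum>u\<in>E. cscale (Poly_Mapping.lookup \<phi> u) (\<Sum>b\<in>B. cscale (\<gamma> u b) b))"
      unfolding lam_def cpoly.scale_sum_left cpoly.scale_sum_right cpoly.scale_scale
      by (rule sum.swap)
    ultimately have "\<phi> - (\<Sum>b\<in>B. cscale (lam \<phi> b) b) =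
        (\<Sum>u\<in>E. cscale (Poly_Mapping.lookup \<phi> u) (mon u - (\<Sum>b\<in>B. cscale (\<gamma> u b) b)))"
      by (simp add: cpoly.scale_right_diff_distrib sum_subtractf)
    also have "\<dots> \<in> Q"
      using \<gamma> subQ by (intro cpoly.subspace_sum cpoly.subspace_scale) (auto simp: E_def)
    finally show ?thesis .
  qed
  \<comment> \<open>Elements of \<open>Q\<close> need not be homogeneous, but \<open>Q\<close> is
    graded and \<open>lam\<close> sees only degree \<open>q\<close>, so \<phi> may be replaced by
    its component.\<close>
  have lam_Q: "lam \<phi> b = 0" if "\<phi> \<in> Q" "b \<in> B" for \<phi> b
  proof -
    have "hcomp q \<phi> \<in> Q"
      using that(1) hcomp_ideal_gen[OF hom] unfolding Q_def by blast
    from cpoly.subspace_diff[OF subQ this lam_mod_Q[OF hcomp_homogeneous, of \<phi>]]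
    have "(\<Sum>b\<in>B. cscale (lam (hcomp q \<phi>) b) b) \<in> Q" by simp
    then have "lam (hcomp q \<phi>) b = 0" using indep that(2) by blast
    then show ?thesis by (simp add: lam_def lookup_hcomp E_def)
  qed
  have lam_B: "lam b b' = (if b = b' then 1 else 0)" if "b \<in> B" "b' \<in> B" for b b'
  proof -
    have "b \<in> homogeneous_part q" using that BW W by blast
    from lam_mod_Q[OF this] have "b - (\<Sum>b'\<in>B. cscale (lam b b') b') \<in> Q" .
    moreover have "b = (\<Sum>b'\<in>B. cscale (if b = b' then 1 else 0) b')"
      using that finB by (simp add: if_distrib[of "\<lambda>c. cscale c _"] cong: if_cong)
    ultimately have "(\<Sum>b'\<in>B. cscale ((if b = b' then 1 else 0) - lam b b') b') \<in> Q"
      by (simp add: cpoly.scale_left_diff_distrib sum_subtractf)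
    from indep[OF this that(2)] show ?thesis by simp
  qed
  have inj: "inj_on g B"
  proof (rule inj_onI)
    fix b b' assume "b \<in> B" "b' \<in> B" "g b = g b'"
    then show "b = b'"
      using mpair_g[of b b] mpair_g[of b b'] lam_B[of b b] lam_B[of b b'] by (auto split: if_splits)
  qed
  have g_hom: "g b \<in> homogeneous_part q" for b
    unfolding g_def using subspace_homogeneous_part
    by (rule cpoly.subspace_sum) (auto simp: homogeneous_part_def E_def)
  have g_perp: "g ` B \<subseteq> perp Q \<inter> homogeneous_part q"
    using g_hom lam_Q unfolding Q_def by (auto simp: perp_ideal_gen_iff mpair_g)
  have "cpoly.independent (g ` B)"
  proof (rule cpoly.independent_if_scalars_zero)
    fix c x assume sum0: "(\<Sum>x\<in>g ` B. cscale (c x) x) = 0" and "x \<in> g ` B"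
    then obtain b where b: "b \<in> B" "x = g b" by blast
    have "0 = mpair b (\<Sum>b\<in>B. cscale (c (g b)) (g b))"
      using sum0 by (simp add: sum.reindex[OF inj] mpair_zero_right)
    also have "\<dots> = (\<Sum>b'\<in>B. c (g b') * lam b b')"
      by (simp add: mpair_sum_right mpair_cscale_right mpair_g)
    also have "\<dots> = c (g b)"
      using b(1) finB by (simp add: lam_B if_distrib[of "\<lambda>x. _ * x"] cong: if_cong)
    finally show "c x = 0" using b(2) by simp
  qed (use finB in simp)
  moreover have "perp Q \<inter> homogeneous_part q \<subseteq> cpoly.span (g ` B)"
  proof
    fix f assume f: "f \<in> perp Q \<inter> homogeneous_part q"
    \<comment> \<open>The remainder of the expansion of \<open>f\<close> in the dual family. It
      pairs to 0 with \<open>Q\<close> and with \<open>B\<close>, hence with every monomial of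
      degree \<open>q\<close>, and so must vanish.\<close>
    define h where "h = f - (\<Sum>b\<in>B. cscale (mpair b f) (g b))"
    have h_pair: "mpair \<phi> h = mpair \<phi> f - (\<Sum>b\<in>B. mpair b f * lam \<phi> b)" for \<phi>
      by (simp add: h_def mpair_diff_right mpair_sum_right mpair_cscale_right mpair_g)
    have h_hom: "h \<in> homogeneous_part q"
      unfolding h_def using f g_hom subspace_homogeneous_part
      by (intro cpoly.subspace_diff cpoly.subspace_sum cpoly.subspace_scale) auto
    have h_Q: "mpair \<phi> h = 0" if "\<phi> \<in> Q" for \<phi>
      using that f unfolding h_pair by (simp add: lam_Q Q_def perp_ideal_gen_iff)
    have h_B: "mpair b h = 0" if "b \<in> B" for b
      using that finB unfolding h_pair
      by (simp add: lam_B if_distrib[of "\<lambda>x. _ * x"] cong: if_cong)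
    have "h = 0"
    proof (rule poly_mapping_eqI)
      fix u
      show "Poly_Mapping.lookup h u = Poly_Mapping.lookup 0 u"
      proof (cases "expo_degree u = q")
        case True
        have "mpair (mon u) h = mpair ((mon u - (\<Sum>b\<in>B. cscale (\<gamma> u b) b)) + (\<Sum>b\<in>B. cscale (\<gamma> u b) b)) h"
          by simp
        also have "\<dots> = 0"
          by (simp only: mpair_add_left mpair_sum_left mpair_cscale_left h_Q[OF \<gamma>[OF True]])
             (simp add: h_B)
        finally show ?thesis by (simp add: mpair_mon_left expo_fact_nonzero)
      next
        case False
        then show ?thesis using h_hom by (auto simp: homogeneous_part_def in_keys_iff)
      qed
    qed
    then have "f = (\<Sum>b\<in>B. cscale (mpair b f) (g b))" by (simp add: h_def)
    also have "\<dots> \<in> cpoly.span (g ` B)"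
      by (intro cpoly.span_sum cpoly.span_scale cpoly.span_base) simp
    finally show "f \<in> cpoly.span (g ` B)" .
  qed
  ultimately have "card (g ` B) = cpoly.dim (perp Q \<inter> homogeneous_part q)"
    using g_perp by (intro cpoly.basis_card_eq_dim)
  then show ?thesis by (simp add: card_image[OF inj])
qed

section \<open>Initial ideals of toric ideals\<close>

lemma keys_monomial_ideal:
  assumes "p \<in> ideal_gen (mon ` U)" and "t \<in> Poly_Mapping.keys p"
  shows "\<exists>u\<in>U. \<exists>c. t = u + c"
  using assms
proof (induction arbitrary: t rule: ideal_gen_induct)
  case (step r s p)
  then obtain u where u: "u \<in> U" "s = mon u" by blast
  consider "t \<in> Poly_Mapping.keys (r * mon u)" | "t \<in> Poly_Mapping.keys p"
    using step.prems u(2) keys_add[of "r * mon u" p] by blast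
  then show ?case
  proof cases
    case 1
    then obtain c where "t = c + u" using keys_mult[of r "mon u"] by auto
    then show ?thesis using u(1) by (metis add.commute)
  next
    case 2
    then show ?thesis by (rule step.IH)
  qed
qed simp

lemma mon_in_monomial_ideal_iff:
  "mon t \<in> ideal_gen (mon ` U) \<longleftrightarrow> (\<exists>u\<in>U. \<exists>c. t = u + c)"
proof
  assume "\<exists>u\<in>U. \<exists>c. t = u + c"
  then obtain u c where "u \<in> U" "t = u + c" by blast
  then have "mon t = mon c * mon u" by (simp add: mon_mult add.commute)
  then show "mon t \<in> ideal_gen (mon ` U)"
    using \<open>u \<in> U\<close> by (simp add: ideal_gen_mult ideal_gen_base)
qed (use keys_monomial_ideal[of "mon t"] in simp)

section \<open>Initial forms of binomials\<close>

lemma lookup_initial_form: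
  "Poly_Mapping.lookup (initial_form w f) u =
     (if \<forall>u'\<in>Poly_Mapping.keys f. weight w u' \<le> weight w u then Poly_Mapping.lookup f u else 0)"
proof -
  let ?S = "{u \<in> Poly_Mapping.keys f. \<forall>u'\<in>Poly_Mapping.keys f. weight w u' \<le> weight w u}"
  have "Poly_Mapping.lookup (initial_form w f) u
      = (\<Sum>u'\<in>?S. if u' = u then Poly_Mapping.lookup f u' else 0)"
    unfolding initial_form_def lookup_sum
    by (intro sum.cong) (auto simp: lookup_single when_def)
  also have "\<dots> = (if u \<in> ?S then Poly_Mapping.lookup f u else 0)"
    by (subst sum.delta) simp_all
  finally show ?thesis by (auto simp: in_keys_iff)
qed

lemma lookup_binomial:
  "Poly_Mapping.lookup (mon p - mon m) u = (if u = p then 1 else 0) - (if u = m then 1 else 0)"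
  by (simp add: lookup_minus lookup_mon)

lemma keys_binomial: "p \<noteq> m \<Longrightarrow> Poly_Mapping.keys (mon p - mon m) = {p, m}"
  by (auto simp: in_keys_iff lookup_binomial split: if_splits)

lemma initial_form_binomial:
  assumes "weight w m < weight w p"
  shows "initial_form w (mon p - mon m) = mon p"
proof -
  have "p \<noteq> m" using assms by auto
  then show ?thesis
    using assms
    by (intro poly_mapping_eqI) (auto simp: lookup_initial_form keys_binomial lookup_binomial lookup_mon)
qed

text \<open>If \<open>m\<close> had maximal weight, its coefficient -1 would survive in the initial
  form, but a monomial has no coefficient -1.\<close>

lemma initial_form_binomial_eq_mon:
  assumes "initial_form w (mon p - mon m) = mon u"
  shows "weight w m < weight w p"
proof (cases "p = m")
  case True
  then have "initial_form w (mon p - mon m) = 0"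
    by (simp add: initial_form_def)
  with assms keys_mon[of u] show ?thesis by simp
next
  case False
  have "Poly_Mapping.lookup (initial_form w (mon p - mon m)) m \<noteq> - 1"
    unfolding assms by (simp add: lookup_mon)
  then show ?thesis
    using False by (auto simp: lookup_initial_form lookup_binomial keys_binomial split: if_splits)
qed

section \<open>Binomials in the toric ideal\<close>

lemma weight_add: "weight w (u + u') = weight w u + weight w u'"
  by (simp add: weight_def lookup_add ring_distribs sum.distrib)

lemma mult_expo_add: "mult_expo A (u + u') = mult_expo A u + mult_expo A u'"
  by (simp add: mult_expo_def vec_eq_iff lookup_add ring_distribs sum.distrib)

text \<open>A term times a generator consists of two terms with opposite coefficients in the same
  fibre of \<open>mult_expo A\<close>, so the coefficients over each fibre add up to 0.\<close>

lemma toric_ideal_fiber_sum: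
  fixes A :: "int ^ 'a::finite ^ 'd::finite"
  assumes "f \<in> toric_ideal A"
  shows "(\<Sum>u\<in>Poly_Mapping.keys f. if mult_expo A u = c then Poly_Mapping.lookup f u else 0) = 0"
proof -
  define F where "F f = (\<Sum>u\<in>Poly_Mapping.keys f.
    (\<lambda>u x. if mult_expo A u = c then x else 0) u (Poly_Mapping.lookup f u))"
    for f :: "'a mpoly"
  have F_add: "F (f + g) = F f + F g" for f g
    unfolding F_def by (rule setsum_keys_plus_distrib) simp_all
  have F_single: "F (Poly_Mapping.single u a) = (if mult_expo A u = c then a else 0)" for u a
    by (cases "a = 0") (simp_all add: F_def)
  have "F f = 0"
    using assms unfolding toric_ideal_def
  proof (induction rule: ideal_gen_induct)
    case (step r s p)
    then obtain u u' where u: "s = mon u - mon u'" "mult_expo A u = mult_expo A u'" by blast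
    have "F (r * s) = 0"
    proof (induction r rule: poly_mapping_add_induct)
      case (single t a)
      have "Poly_Mapping.single t a * s
          = Poly_Mapping.single (t + u) a + Poly_Mapping.single (t + u') (- a)"
        by (simp add: u mon_def ring_distribs mult_single single_uminus)
      then show ?case by (simp add: F_add F_single mult_expo_add u)
    qed (simp add: ring_distribs F_add)
    then show ?case using step by (simp add: F_add)
  qed (simp add: F_def)
  then show ?thesis by (simp add: F_def)
qed

text \<open>Were the two exponents in different fibres, the coefficient sum over the fibre of
  \<open>p\<close> would be 1.\<close>

lemma binomial_in_toric_ideal_iff:
  "mon p - mon m \<in> toric_ideal A \<longleftrightarrow> mult_expo A p = mult_expo A m"
proof
  assume toric: "mon p - mon m \<in> toric_ideal A"
  show "mult_expo A p = mult_expo A m"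
  proof (cases "p = m")
    case False
    then show ?thesis
      using toric_ideal_fiber_sum[OF toric, of "mult_expo A p"]
      by (auto simp: keys_binomial lookup_binomial split: if_splits)
  qed simp
qed (auto simp: toric_ideal_def intro: ideal_gen_base)

lemma initial_form_in_initial_ideal: "f \<in> I \<Longrightarrow> initial_form w f \<in> initial_ideal w I"
  unfolding initial_ideal_def by (rule ideal_gen_base) simp

section \<open>Independence of the columns on the face of a standard pair\<close>

lemma lookup_Abs_expo: "Poly_Mapping.lookup (Abs_poly_mapping f) = f"
  for f :: "'n::finite \<Rightarrow> nat"
  by (rule lookup_Abs_poly_mapping) simp

text \<open>Here the monomiality of the initial ideal enters: a kernel vector supported on the face
  of a standard pair would put a monomial supported on that face into the ideal.\<close>

lemma standard_pair_columns_independent: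
  fixes A :: "int ^ 'n::finite ^ 'd::finite"
  assumes M: "initial_ideal w (toric_ideal A) = ideal_gen (mon ` U)"
    and sp: "(a, \<sigma>) \<in> standard_pairs (initial_ideal w (toric_ideal A))"
    and ker: "\<And>i. (\<Sum>k\<in>\<sigma>. A $ i $ k * u k) = 0" and k: "k \<in> \<sigma>"
  shows "u k = 0"
proof (rule ccontr)
  assume "u k \<noteq> 0"
  \<comment> \<open>\<open>p\<close> and \<open>m\<close> are the positive and negative parts of the
    kernel vector, cut off to the face.\<close>
  define p where "p = (Abs_poly_mapping (\<lambda>j. if j \<in> \<sigma> then nat (u j) else 0) :: 'n expo)"
  define m where "m = (Abs_poly_mapping (\<lambda>j. if j \<in> \<sigma> then nat (- u j) else 0) :: 'n expo)"
  have p: "Poly_Mapping.lookup p j = (if j \<in> \<sigma> then nat (u j) else 0)"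
    and m: "Poly_Mapping.lookup m j = (if j \<in> \<sigma> then nat (- u j) else 0)" for j
    by (simp_all add: p_def m_def lookup_Abs_expo)
  have supp: "Poly_Mapping.keys p \<subseteq> \<sigma>" "Poly_Mapping.keys m \<subseteq> \<sigma>"
    by (auto simp: in_keys_iff p m split: if_splits)
  have "p \<noteq> m"
  proof
    assume "p = m"
    then have "nat (u k) = nat (- u k)" using p[of k] m[of k] k by simp
    with \<open>u k \<noteq> 0\<close> show False by linarith
  qed
  have "(\<Sum>j\<in>UNIV. A $ i $ j * int (Poly_Mapping.lookup p j))
      - (\<Sum>j\<in>UNIV. A $ i $ j * int (Poly_Mapping.lookup m j)) = 0" for i
  proof -
    have "(\<Sum>j\<in>UNIV. A $ i $ j * int (Poly_Mapping.lookup p j))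
        - (\<Sum>j\<in>UNIV. A $ i $ j * int (Poly_Mapping.lookup m j))
        = (\<Sum>j\<in>UNIV. if j \<in> \<sigma> then A $ i $ j * u j else 0)"
      unfolding sum_subtractf[symmetric]
      by (intro sum.cong) (auto simp: p m right_diff_distrib[symmetric])
    also have "\<dots> = 0" using ker[of i] by (simp add: sum.If_cases)
    finally show ?thesis .
  qed
  then have "mult_expo A p = mult_expo A m"
    by (simp add: mult_expo_def vec_eq_iff)
  then have toric: "mon p - mon m \<in> toric_ideal A"
    by (simp add: binomial_in_toric_ideal_iff)
  \<comment> \<open>Whichever exponent has maximal weight survives in the initial form. The weights
    may be equal, since a monomial ideal contains every single term of its elements.\<close>
  have "\<exists>t\<in>{p, m}. t \<in> Poly_Mapping.keys (initial_form w (mon p - mon m))"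
    using \<open>p \<noteq> m\<close> linear[of "weight w p" "weight w m"]
    by (auto simp: in_keys_iff lookup_initial_form keys_binomial lookup_binomial)
  then obtain t where t: "t \<in> {p, m}" "t \<in> Poly_Mapping.keys (initial_form w (mon p - mon m))"
    by blast
  have "mon t \<in> ideal_gen (mon ` U)"
    unfolding mon_in_monomial_ideal_iff
    using keys_monomial_ideal[OF _ t(2)] initial_form_in_initial_ideal[OF toric, of w] M by blast
  then have "mon (a + t) \<in> initial_ideal w (toric_ideal A)"
    unfolding M mon_mult[symmetric] by (rule ideal_gen_mult)
  moreover have "Poly_Mapping.keys t \<subseteq> \<sigma>" using t(1) supp by blast
  ultimately show False using sp by (auto simp: standard_pairs_def)
qed

text \<open>Clears denominators, so that a rational relation between columns becomes an integral
  one.\<close>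

lemma common_denominator:
  fixes r :: "'a \<Rightarrow> rat"
  assumes "finite S"
  shows "\<exists>N::int. N \<noteq> 0 \<and> (\<forall>k\<in>S. \<exists>z. of_int N * r k = of_int z)"
  using assms
proof (induction S)
  case empty
  show ?case by (rule exI[of _ 1]) simp
next
  case (insert x S)
  then obtain N :: int where N: "N \<noteq> 0" "\<forall>k\<in>S. \<exists>z. of_int N * r k = of_int z" by blast
  obtain a b where ab: "quotient_of (r x) = (a, b)" by force
  have b: "b \<noteq> 0" "r x = of_int a / of_int b"
    using quotient_of_denom_pos[OF ab] quotient_of_div[OF ab] by auto
  have "\<exists>z. of_int (b * N) * r k = of_int z" if "k \<in> insert x S" for k
  proof (cases "k = x")
    case True
    have "of_int (b * N) * r x = of_int (N * a)" using b by simp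
    then show ?thesis unfolding True by (rule exI)
  next
    case False
    with that have "k \<in> S" by simp
    with N(2) obtain z where "of_int N * r k = of_int z" by auto
    then have "of_int (b * N) * r k = of_int (b * z)"
      by (simp only: of_int_mult mult.assoc)
    then show ?thesis by (rule exI)
  qed
  moreover have "b * N \<noteq> 0" using N(1) b(1) by simp
  ultimately show ?case by blast
qed

text \<open>Independent columns admit a linear functional that is 1 on column \<open>j\<close> and 0
  on the other columns of the face; \<open>y\<close> lists its values on the unit vectors.\<close>

lemma dual_row_combination:
  fixes A :: "int ^ 'n::finite ^ 'd::finite"
  assumes ker: "\<forall>u. (\<forall>i. (\<Sum>k\<in>\<sigma>. A $ i $ k * u k) = 0) \<longrightarrow> (\<forall>k\<in>\<sigma>. u k = 0)"
  shows "\<exists>y :: 'd \<Rightarrow> rat. \<forall>k\<in>\<sigma>. (\<Sum>i\<in>UNIV. y i * of_int (A $ i $ k)) = (if k = j then 1 else 0)"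
proof -
  define col where "col k = (\<chi> i. rat_of_int (A $ i $ k))" for k
  have ker_rat: "r k = 0" if r: "(\<Sum>k\<in>\<sigma>. r k *s col k) = 0" and k: "k \<in> \<sigma>" for r :: "'n \<Rightarrow> rat" and k
  proof -
    obtain N :: int where N: "N \<noteq> 0" "\<forall>k\<in>\<sigma>. \<exists>z. of_int N * r k = of_int z"
      using common_denominator[of \<sigma> r] by auto
    then obtain z where z: "\<And>k. k \<in> \<sigma> \<Longrightarrow> of_int N * r k = of_int (z k)" by metis
    have "(\<Sum>k\<in>\<sigma>. A $ i $ k * z k) = 0" for i
    proof -
      have "of_int (\<Sum>k\<in>\<sigma>. A $ i $ k * z k) = (\<Sum>k\<in>\<sigma>. of_int N * (r k * of_int (A $ i $ k)))"
        unfolding of_int_sum by (rule sum.cong) (simp_all add: z[symmetric] mult_ac)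
      also have "\<dots> = of_int N * ((\<Sum>k\<in>\<sigma>. r k *s col k) $ i)"
        by (simp add: sum_distrib_left col_def)
      finally show ?thesis using r by (metis mult_zero_right of_int_eq_0_iff zero_index)
    qed
    then have "z k = 0" using ker k by blast
    then show ?thesis using z[OF k] N(1) by simp
  qed
  \<comment> \<open>Independence concerns the set of columns and cannot see repetitions; two equal
    columns are excluded by the relation with coefficients 1 and -1.\<close>
  have inj: "inj_on col \<sigma>"
  proof (rule inj_onI, rule ccontr)
    fix k l assume kl: "k \<in> \<sigma>" "l \<in> \<sigma>" "col k = col l" "k \<noteq> l"
    have "(\<Sum>m\<in>\<sigma>. ((if m = k then 1 else 0) - (if m = l then 1 else 0)) *s col m) = 0"
      using kl by (simp add: vec_eq_iff left_diff_distrib sum_subtractf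
          if_distrib[of "\<lambda>x. x * _"] cong: if_cong)
    from ker_rat[OF this kl(1)] kl(4) show False by simp
  qed
  have indep: "vec.independent (col ` \<sigma>)"
  proof (rule vec.independent_if_scalars_zero)
    fix f x assume f: "(\<Sum>x\<in>col ` \<sigma>. f x *s x) = 0" and "x \<in> col ` \<sigma>"
    then obtain k where "k \<in> \<sigma>" "x = col k" by blast
    then show "f x = 0"
      using ker_rat[of "\<lambda>k. f (col k)"] f by (simp add: sum.reindex[OF inj])
  qed simp
  interpret vector_space_pair "(*s) :: rat \<Rightarrow> rat ^ 'd \<Rightarrow> rat ^ 'd" "(*) :: rat \<Rightarrow> rat \<Rightarrow> rat"
    by unfold_locales
  obtain g where g: "Vector_Spaces.linear (*s) (*) g" "\<forall>x\<in>col ` \<sigma>. g x = (if x = col j then 1 else 0)"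
    using linear_independent_extend[OF indep, of "\<lambda>x. if x = col j then 1 else 0"] by blast
  interpret g: Vector_Spaces.linear "(*s) :: rat \<Rightarrow> rat ^ 'd \<Rightarrow> rat ^ 'd" "(*) :: rat \<Rightarrow> rat \<Rightarrow> rat" g
    by (rule g(1))
  show ?thesis
  proof (cases "j \<in> \<sigma>")
    case True
    have "(\<Sum>i\<in>UNIV. g (axis i 1) * of_int (A $ i $ k)) = (if k = j then 1 else 0)" if "k \<in> \<sigma>" for k
    proof -
      have "g (col k) = g (\<Sum>i\<in>UNIV. (col k $ i) *s axis i 1)"
        by (simp add: basis_expansion)
      also have "\<dots> = (\<Sum>i\<in>UNIV. g (axis i 1) * of_int (A $ i $ k))"
        by (simp add: g.sum g.scale col_def mult.commute)
      finally show ?thesis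
        using g(2) that inj_on_eq_iff[OF inj that True] by simp
    qed
    then show ?thesis by (intro exI[of _ "\<lambda>i. g (axis i 1)"] ballI)
  next
    case False
    then show ?thesis by (intro exI[of _ "\<lambda>_. 0"]) auto
  qed
qed

text \<open>Combining the rows with the dual coefficients removes every variable of the face except
  \<open>j\<close>, so modulo the row forms \<open>j\<close> is expressed through variables outside
  the face.\<close>

lemma row_form_combination:
  fixes A :: "int ^ 'n::finite ^ 'd::finite"
  assumes ker: "\<forall>u. (\<forall>i. (\<Sum>k\<in>\<sigma>. A $ i $ k * u k) = 0) \<longrightarrow> (\<forall>k\<in>\<sigma>. u k = 0)" and j: "j \<in> \<sigma>"
  shows "\<exists>c. pvar j + (\<Sum>k\<in>- \<sigma>. pconst (c k) * pvar k) \<in> ideal_gen (range (row_form A))"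
proof -
  obtain y :: "'d \<Rightarrow> rat"
    where y: "\<forall>k\<in>\<sigma>. (\<Sum>i\<in>UNIV. y i * of_int (A $ i $ k)) = (if k = j then 1 else 0)"
    using dual_row_combination[OF ker, of j] ..
  define c :: "'n \<Rightarrow> complex" where "c k = of_rat (\<Sum>i\<in>UNIV. y i * of_int (A $ i $ k))" for k
  have pconst_sum: "pconst (\<Sum>i\<in>I. f i) = (\<Sum>i\<in>I. pconst (f i))" for I and f :: "'d \<Rightarrow> complex"
    by (induction I rule: infinite_finite_induct) (simp_all add: subst_hom.c_zero subst_hom.c_add)
  have "(\<Sum>i\<in>UNIV. pconst (of_rat (y i)) * row_form A i)
      = (\<Sum>i\<in>UNIV. \<Sum>k\<in>UNIV. pconst (of_rat (y i * of_int (A $ i $ k))) * pvar k)"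
    by (simp add: row_form_def sum_distrib_left subst_hom.c_mult of_rat_mult mult.assoc)
  also have "\<dots> = (\<Sum>k\<in>UNIV. pconst (c k) * pvar k)"
    by (subst sum.swap) (simp add: c_def of_rat_sum pconst_sum sum_distrib_right)
  also have "\<dots> = (\<Sum>k\<in>\<sigma>. pconst (c k) * pvar k) + (\<Sum>k\<in>- \<sigma>. pconst (c k) * pvar k)"
    using sum.subset_diff[of \<sigma> UNIV "\<lambda>k. pconst (c k) * pvar k"]
    by (simp add: Compl_eq_Diff_UNIV add.commute)
  also have "(\<Sum>k\<in>\<sigma>. pconst (c k) * pvar k) = (\<Sum>k\<in>\<sigma>. if k = j then pvar j else 0)"
    by (rule sum.cong) (use y in \<open>auto simp: c_def subst_hom.c_one subst_hom.c_zero\<close>)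
  also have "\<dots> = pvar j" using j by simp
  finally have "pvar j + (\<Sum>k\<in>- \<sigma>. pconst (c k) * pvar k)
      = (\<Sum>i\<in>UNIV. pconst (of_rat (y i)) * row_form A i)" ..
  also have "\<dots> \<in> ideal_gen (range (row_form A))"
    by (intro ideal_gen_sum ideal_gen_mult ideal_gen_base) simp
  finally show ?thesis by blast
qed

section \<open>The link of a fake exponent\<close>

locale toric_groebner =
  fixes A :: "int ^ 'n::finite ^ 'd::finite" and w :: "real ^ 'n"
    and m :: nat and gp gm :: "nat \<Rightarrow> 'n expo"
  assumes gb: "is_reduced_groebner_basis w (toric_ideal A) ((\<lambda>i. mon (gp i) - mon (gm i)) ` {1..m})"
begin

abbreviation binom :: "nat \<Rightarrow> 'n mpoly" where
  "binom i \<equiv> mon (gp i) - mon (gm i)"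

lemma weight_less: "i \<in> {1..m} \<Longrightarrow> weight w (gm i) < weight w (gp i)"
  using gb initial_form_binomial_eq_mon unfolding is_reduced_groebner_basis_def by blast

lemma initial_form_binom: "i \<in> {1..m} \<Longrightarrow> initial_form w (binom i) = mon (gp i)"
  by (rule initial_form_binomial[OF weight_less])

lemma initial_ideal_eq: "initial_ideal w (toric_ideal A) = ideal_gen (mon ` gp ` {1..m})"
proof -
  have "initial_form w ` binom ` {1..m} = mon ` gp ` {1..m}"
    unfolding image_image by (rule image_cong) (simp_all add: initial_form_binom)
  then show ?thesis using gb unfolding is_reduced_groebner_basis_def by metis
qed

lemma mon_in_initial_ideal_iff:
  "mon t \<in> initial_ideal w (toric_ideal A) \<longleftrightarrow> (\<exists>i\<in>{1..m}. \<exists>c. t = gp i + c)"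
  unfolding initial_ideal_eq mon_in_monomial_ideal_iff by blast

text \<open>A common variable could be cancelled from the binomial, leaving a smaller leading monomial.\<close>

lemma gp_gm_disjoint:
  assumes i: "i \<in> {1..m}"
  shows "Poly_Mapping.lookup (gp i) j = 0 \<or> Poly_Mapping.lookup (gm i) j = 0"
proof (rule ccontr)
  assume neg: "\<not> ?thesis"
  define e where "e = Poly_Mapping.single j (1::nat)"
  have cancel: "u = e + (u - e)" if "Poly_Mapping.lookup u j \<noteq> 0" for u
    using that by (intro poly_mapping_eqI) (auto simp: e_def lookup_add lookup_minus lookup_single when_def)
  define p' where "p' = gp i - e"
  define m' where "m' = gm i - e"
  have p: "gp i = e + p'" and m: "gm i = e + m'"
    unfolding p'_def m'_def using neg by (auto intro: cancel)
  have "binom i \<in> toric_ideal A"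
    using gb i ideal_gen_base[of "binom i" "binom ` {1..m}"]
    unfolding is_reduced_groebner_basis_def by blast
  then have toric: "mon p' - mon m' \<in> toric_ideal A"
    by (simp add: binomial_in_toric_ideal_iff p m mult_expo_add)
  have "weight w m' < weight w p'"
    using weight_less[OF i] by (simp add: p m weight_add)
  then have "mon p' \<in> initial_ideal w (toric_ideal A)"
    using initial_form_in_initial_ideal[OF toric, of w] by (simp add: initial_form_binomial)
  then obtain k c where k: "k \<in> {1..m}" "p' = gp k + c"
    unfolding mon_in_initial_ideal_iff by blast
  \<comment> \<open>The smaller degree shows that \<open>k\<close> gives a different basis element;
    its leading monomial divides that of \<open>i\<close>, against reducedness.\<close>
  have "expo_degree (gp k) < expo_degree (gp i)"
    by (simp add: p k expo_degree_add e_def expo_degree_single)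
  then have "mon (gp k) \<noteq> mon (gp i)" by auto
  then have "initial_form w (binom k) \<noteq> initial_form w (binom i)"
    by (simp only: initial_form_binom[OF i] initial_form_binom[OF k(1)] not_False_eq_True)
  then have "binom k \<noteq> binom i" by (rule contrapos_nn) (rule arg_cong)
  then have "binom k \<in> binom ` {1..m} - {binom i}"
    using k(1) by blast
  then have "initial_form w (binom k) \<in> initial_form w ` (binom ` {1..m} - {binom i})"
    by (rule imageI)
  then have "mon (gp k) \<in> initial_form w ` (binom ` {1..m} - {binom i})"
    by (simp only: initial_form_binom[OF k(1)])
  then have "mon (e + c) * mon (gp k) \<in> ideal_gen (initial_form w ` (binom ` {1..m} - {binom i}))"
    by (intro ideal_gen_mult ideal_gen_base)
  then have "mon (gp i) \<in> ideal_gen (initial_form w ` (binom ` {1..m} - {binom i}))"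
    by (simp add: mon_mult p k add_ac)
  moreover have "gp i \<in> Poly_Mapping.keys (binom i)"
    using weight_less[OF i] by (subst keys_binomial) auto
  ultimately show False
    using gb i unfolding is_reduced_groebner_basis_def by blast
qed

text \<open>If \<open>v $ j\<close> is not a negative integer but becomes one after subtracting
  \<open>gp - gm\<close>, it is a natural number below \<open>gp\<close>. The converse needs
  \<open>gm\<close> to vanish at \<open>j\<close>, which is the disjointness of supports.\<close>

lemma G_set_iff:
  assumes i: "i \<in> {1..m}"
  shows "j \<in> G_set v (gp i) (gm i) \<longleftrightarrow> (\<exists>a. v $ j = of_nat a \<and> a < Poly_Mapping.lookup (gp i) j)"
proof -
  let ?p = "Poly_Mapping.lookup (gp i) j" and ?m = "Poly_Mapping.lookup (gm i) j"
  have G: "j \<in> G_set v (gp i) (gm i) \<longleftrightarrow>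
      (\<exists>k<0. v $ j + of_int (- (int ?p - int ?m)) = of_int k) \<and> \<not> (\<exists>k<0. v $ j = of_int k)"
    by (simp add: G_set_def nsupp_shift_def nsupp_def)
  show ?thesis
  proof
    assume "j \<in> G_set v (gp i) (gm i)"
    then obtain k where k: "k < 0" "v $ j + of_int (- (int ?p - int ?m)) = of_int k"
      and nonneg: "\<not> (\<exists>k<0. v $ j = of_int k)"
      unfolding G by blast
    define z where "z = k + (int ?p - int ?m)"
    have vz: "v $ j = of_int z"
      using k(2) by (simp add: z_def algebra_simps)
    then have "0 \<le> z" using nonneg by force
    then have "v $ j = of_nat (nat z)" using vz by simp
    moreover have "nat z < ?p" using k(1) \<open>0 \<le> z\<close> by (simp add: z_def)
    ultimately show "\<exists>a. v $ j = of_nat a \<and> a < ?p" by blast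
  next
    assume "\<exists>a. v $ j = of_nat a \<and> a < ?p"
    then obtain a where a: "v $ j = of_nat a" "a < ?p" by blast
    then have "?m = 0" using gp_gm_disjoint[OF i, of j] by simp
    then have "v $ j + of_int (- (int ?p - int ?m)) = of_int (int a - int ?p)"
      using a(1) by simp
    moreover have "int a - int ?p < 0" using a(2) by simp
    moreover have "\<not> (\<exists>k<0. v $ j = of_int k)"
    proof clarify
      fix k :: int assume "k < 0" "v $ j = of_int k"
      then have "of_int (int a) = (of_int k :: complex)" using a(1) by simp
      then have "int a = k" by (simp only: of_int_eq_iff)
      with \<open>k < 0\<close> show False by simp
    qed
    ultimately show "j \<in> G_set v (gp i) (gm i)" unfolding G by blast
  qed
qed

section \<open>Standard pairs at the exponent and faces of the link\<close>

lemma G_set_disjoint_nsupp: "G_set v (gp i) (gm i) \<subseteq> - nsupp v"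
  by (auto simp: G_set_def)

text \<open>Off the face of such a pair the coordinates of \<open>v\<close> are natural numbers,
  hence not negative.\<close>

lemma standard_pairs_at_nsupp_subset:
  assumes "(a, \<sigma>) \<in> standard_pairs_at A w v"
  shows "nsupp v \<subseteq> \<sigma>"
proof
  fix j assume "j \<in> nsupp v"
  then obtain k :: int where k: "k < 0" "v $ j = of_int k" by (auto simp: nsupp_def)
  show "j \<in> \<sigma>"
  proof (rule ccontr)
    assume "j \<notin> \<sigma>"
    then have "of_int k = (of_int (int (Poly_Mapping.lookup a j)) :: complex)"
      using assms k by (simp add: standard_pairs_at_def)
    then have "k = int (Poly_Mapping.lookup a j)" by (simp only: of_int_eq_iff)
    with k(1) show False by simp
  qed
qed

text \<open>The set \<open>\<tau>\<close> is enlarged by the coordinates of \<open>v\<close> that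
  are not natural numbers, and then to a largest set still satisfying the first two conditions on a
  standard pair; maximality gives the third.\<close>

lemma standard_pair_extends:
  assumes \<tau>: "\<forall>i\<in>{1..m}. \<not> G_set v (gp i) (gm i) \<subseteq> \<tau>"
  shows "\<exists>(a, \<sigma>)\<in>standard_pairs_at A w v. \<tau> \<subseteq> \<sigma>"
proof -
  let ?M = "initial_ideal w (toric_ideal A)"
  define N where "N = {j. \<exists>a::nat. v $ j = of_nat a}"
  have "\<forall>j. \<exists>a::nat. j \<in> N \<longrightarrow> v $ j = of_nat a" by (auto simp: N_def)
  from choice[OF this] obtain val where val: "\<And>j. j \<in> N \<Longrightarrow> v $ j = of_nat (val j)"
    by auto
  \<comment> \<open>The monomial part that the condition \<open>v $ j = a_j\<close> off the face
    prescribes.\<close>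
  define trunc where "trunc \<sigma> = (Abs_poly_mapping (\<lambda>j. if j \<in> \<sigma> then 0 else val j) :: 'n expo)" for \<sigma>
  have lookup_trunc: "Poly_Mapping.lookup (trunc \<sigma>) j = (if j \<in> \<sigma> then 0 else val j)" for \<sigma> j
    by (simp add: trunc_def lookup_Abs_expo)
  define free where "free \<sigma> \<longleftrightarrow> \<tau> \<union> - N \<subseteq> \<sigma> \<and>
    (\<forall>b. Poly_Mapping.keys b \<subseteq> \<sigma> \<longrightarrow> mon (trunc \<sigma> + b) \<notin> ?M)" for \<sigma>
  have "free (\<tau> \<union> - N)"
    unfolding free_def
  proof (intro conjI allI impI)
    fix b :: "'n expo" assume b: "Poly_Mapping.keys b \<subseteq> \<tau> \<union> - N"
    show "mon (trunc (\<tau> \<union> - N) + b) \<notin> ?M"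
    proof
      assume "mon (trunc (\<tau> \<union> - N) + b) \<in> ?M"
      then obtain i c where i: "i \<in> {1..m}" "trunc (\<tau> \<union> - N) + b = gp i + c"
        unfolding mon_in_initial_ideal_iff by blast
      \<comment> \<open>At this \<open>j\<close> the exponent is too small for \<open>gp i\<close>,
        and \<open>b\<close> cannot raise it because \<open>j\<close> lies outside
        \<open>\<tau>\<close> and inside \<open>N\<close>.\<close>
      obtain j where j: "j \<in> G_set v (gp i) (gm i)" "j \<notin> \<tau>" using \<tau> i(1) by blast
      then obtain a where a: "v $ j = of_nat a" "a < Poly_Mapping.lookup (gp i) j"
        using G_set_iff[OF i(1)] by blast
      then have "j \<in> N" by (auto simp: N_def)
      then have "val j = a" using val[of j] a(1) by simp
      have "Poly_Mapping.lookup b j = 0" using b j(2) \<open>j \<in> N\<close> not_in_keys_iff_lookup_eq_zero by fastforce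
      then have "val j = Poly_Mapping.lookup (gp i) j + Poly_Mapping.lookup c j"
        using arg_cong[OF i(2), of "\<lambda>u. Poly_Mapping.lookup u j"] j(2) \<open>j \<in> N\<close>
        by (simp add: lookup_add lookup_trunc)
      with a(2) \<open>val j = a\<close> show False by simp
    qed
  qed simp
  then obtain \<sigma> where \<sigma>: "free \<sigma>" and max: "\<And>\<sigma>'. free \<sigma>' \<Longrightarrow> card \<sigma>' \<le> card \<sigma>"
    using ex_has_greatest_nat[of free "\<tau> \<union> - N" card "Suc CARD('n)"]
    by (auto simp: less_Suc_eq_le card_mono)
  have "(trunc \<sigma>, \<sigma>) \<in> standard_pairs ?M"
    unfolding standard_pairs_def
  proof (intro CollectI case_prodI conjI allI impI ballI)
    fix l assume l: "l \<notin> \<sigma>"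
    then have "\<not> free (insert l \<sigma>)"
      using max[of "insert l \<sigma>"] by auto
    then obtain b where b: "Poly_Mapping.keys b \<subseteq> insert l \<sigma>" "mon (trunc (insert l \<sigma>) + b) \<in> ?M"
      using \<sigma> by (auto simp: free_def)
    \<comment> \<open>Enlarging the face by \<open>l\<close> erases the exponent at
      \<open>l\<close>; multiplying by this power restores it and stays in the ideal.\<close>
    define e where "e = Poly_Mapping.single l (val l)"
    have "trunc \<sigma> = e + trunc (insert l \<sigma>)"
      using l by (intro poly_mapping_eqI) (auto simp: e_def lookup_add lookup_trunc lookup_single when_def)
    then have "mon (trunc \<sigma> + b) = mon e * mon (trunc (insert l \<sigma>) + b)"
      by (simp add: mon_mult add.assoc)
    also have "\<dots> \<in> ?M"
      using b(2) unfolding initial_ideal_def by (rule ideal_gen_mult)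
    finally show "\<exists>b. Poly_Mapping.keys b \<subseteq> insert l \<sigma> \<and> mon (trunc \<sigma> + b) \<in> ?M"
      using b(1) by blast
  qed (use \<sigma> in \<open>auto simp: lookup_trunc free_def\<close>)
  moreover have "v $ j = of_nat (Poly_Mapping.lookup (trunc \<sigma>) j)" if "j \<notin> \<sigma>" for j
    using that \<sigma> val[of j] by (auto simp: lookup_trunc free_def)
  ultimately have "(trunc \<sigma>, \<sigma>) \<in> standard_pairs_at A w v"
    by (simp add: standard_pairs_at_def)
  moreover have "\<tau> \<subseteq> \<sigma>" using \<sigma> by (simp add: free_def)
  ultimately show ?thesis by blast
qed

text \<open>Off the face \<open>a\<close> agrees with \<open>v\<close>, so outside
  \<open>G_set\<close> it already dominates \<open>gp i\<close>; on the face any exponent may be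
  added. Containment would thus produce a multiple of the leading monomial.\<close>

lemma G_set_not_subset_standard_pair:
  assumes sp: "(a, \<sigma>) \<in> standard_pairs_at A w v" and i: "i \<in> {1..m}"
  shows "\<not> G_set v (gp i) (gm i) \<subseteq> \<sigma>"
proof
  assume sub: "G_set v (gp i) (gm i) \<subseteq> \<sigma>"
  define b where "b = (Abs_poly_mapping (\<lambda>j. if j \<in> \<sigma> then Poly_Mapping.lookup (gp i) j else 0) :: 'n expo)"
  have b: "Poly_Mapping.lookup b j = (if j \<in> \<sigma> then Poly_Mapping.lookup (gp i) j else 0)" for j
    by (simp add: b_def lookup_Abs_expo)
  have "Poly_Mapping.lookup (gp i) j \<le> Poly_Mapping.lookup (a + b) j" for j
  proof (cases "j \<in> \<sigma>")
    case False
    then have "v $ j = of_nat (Poly_Mapping.lookup a j)" "j \<notin> G_set v (gp i) (gm i)"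
      using sp sub by (auto simp: standard_pairs_at_def)
    then have "Poly_Mapping.lookup (gp i) j \<le> Poly_Mapping.lookup a j"
      using G_set_iff[OF i] not_less by blast
    then show ?thesis by (simp add: lookup_add)
  qed (simp add: lookup_add b)
  then have "a + b = gp i + (a + b - gp i)"
    by (intro poly_mapping_eqI) (simp only: lookup_add[of "gp i"] lookup_minus le_add_diff_inverse)
  then have "mon (a + b) \<in> initial_ideal w (toric_ideal A)"
    unfolding mon_in_initial_ideal_iff using i by blast
  moreover have "Poly_Mapping.keys b \<subseteq> \<sigma>" by (auto simp: in_keys_iff b split: if_splits)
  ultimately show False
    using sp by (auto simp: standard_pairs_at_def standard_pairs_def)
qed

text \<open>The face of every standard pair at \<open>v\<close> contains \<open>nsupp v\<close>, so
  adjoining \<open>nsupp v\<close> does not change whether \<open>\<tau>\<close> fits into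
  it.\<close>

lemma link_complex_iff:
  assumes "\<tau> \<subseteq> - nsupp v"
  shows "\<tau> \<in> link_complex A w v \<longleftrightarrow> (\<forall>i\<in>{1..m}. \<not> G_set v (gp i) (gm i) \<subseteq> \<tau>)"
proof
  assume "\<tau> \<in> link_complex A w v"
  then show "\<forall>i\<in>{1..m}. \<not> G_set v (gp i) (gm i) \<subseteq> \<tau>"
    unfolding link_complex_def Delta_complex_def using G_set_not_subset_standard_pair by blast
next
  assume "\<forall>i\<in>{1..m}. \<not> G_set v (gp i) (gm i) \<subseteq> \<tau>"
  then obtain a \<sigma> where "(a, \<sigma>) \<in> standard_pairs_at A w v" "\<tau> \<subseteq> \<sigma>"
    using standard_pair_extends by blast
  moreover from this have "nsupp v \<subseteq> \<sigma>" using standard_pairs_at_nsupp_subset by blast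
  ultimately show "\<tau> \<in> link_complex A w v"
    using assms unfolding link_complex_def Delta_complex_def by blast
qed

text \<open>Some falling factorial must vanish at \<open>v\<close>, and a root of it is a natural
  number below the exponent in \<open>gp i\<close>.\<close>

lemma G_set_nonempty:
  assumes fake: "fake_exponent A \<beta> w v" and i: "i \<in> {1..m}"
  shows "G_set v (gp i) (gm i) \<noteq> {}"
proof -
  have "mon (gp i) \<in> initial_ideal w (toric_ideal A)"
    unfolding mon_in_initial_ideal_iff using i by (metis add_0_right)
  then have "eval_mpoly v (falling_poly (gp i)) = 0"
    using fake falling_poly_in_fake_indicial_ideal unfolding fake_exponent_def by blast
  then obtain j where "falling (v $ j) (Poly_Mapping.lookup (gp i) j) = 0"
    unfolding eval_falling_poly by auto
  then obtain a where "a < Poly_Mapping.lookup (gp i) j" "v $ j = of_nat a"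
    unfolding falling_def by auto
  then show ?thesis using G_set_iff[OF i] by blast
qed

lemma link_face_form:
  assumes "\<tau> \<in> link_complex A w v" and "j \<in> \<tau> \<union> nsupp v"
  shows "\<exists>c. pvar j + (\<Sum>k\<in>- (\<tau> \<union> nsupp v). pconst (c k) * pvar k) \<in> ideal_gen (range (row_form A))"
proof -
  obtain a \<sigma> where sp: "(a, \<sigma>) \<in> standard_pairs (initial_ideal w (toric_ideal A))" "\<tau> \<union> nsupp v \<subseteq> \<sigma>"
    using assms(1) unfolding link_complex_def Delta_complex_def standard_pairs_at_def by blast
  have "\<forall>u. (\<forall>i. (\<Sum>k\<in>\<tau> \<union> nsupp v. A $ i $ k * u k) = 0) \<longrightarrow> (\<forall>k\<in>\<tau> \<union> nsupp v. u k = 0)"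
  proof (intro allI impI ballI)
    fix u k assume ker: "\<forall>i. (\<Sum>k\<in>\<tau> \<union> nsupp v. A $ i $ k * u k) = 0" and k: "k \<in> \<tau> \<union> nsupp v"
    \<comment> \<open>Extension by 0 turns a kernel vector on the smaller set into one on the whole
      face of the standard pair.\<close>
    let ?u = "\<lambda>k. if k \<in> \<tau> \<union> nsupp v then u k else 0"
    have "(\<Sum>k\<in>\<sigma>. A $ i $ k * ?u k) = (\<Sum>k\<in>\<tau> \<union> nsupp v. A $ i $ k * u k)" for i
      using sp(2) by (intro sum.mono_neutral_cong_right) auto
    then have "(\<Sum>k\<in>\<sigma>. A $ i $ k * ?u k) = 0" for i
      using ker by simp
    moreover have "k \<in> \<sigma>" using k sp(2) by blast
    ultimately have "?u k = 0"
      by (rule standard_pair_columns_independent[OF initial_ideal_eq sp(1)])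
    then show "u k = 0" using k by simp
  qed
  from row_form_combination[OF this assms(2)] show ?thesis .
qed

end

section \<open>Polynomials in a subset of the variables\<close>

lemma pvar_power: "pvar j ^ k = mon (Poly_Mapping.single j k)"
  by (induction k) (simp_all add: pvar_def mon_mult flip: single_add)

lemma prod_pvar_power: "(\<Prod>j\<in>UNIV. pvar j ^ Poly_Mapping.lookup u j) = mon u"
  for u :: "'n::finite expo"
  by (simp add: pvar_power sum_single_lookup flip: mon_sum)

lemma prod_pvar: "(\<Prod>j\<in>S. pvar j) = mon (\<Sum>j\<in>S. Poly_Mapping.single j 1)"
  by (simp add: pvar_def mon_sum)

lemma sum_pconst_mon: "(\<Sum>u\<in>Poly_Mapping.keys p. pconst (Poly_Mapping.lookup p u) * mon u) = p"
  unfolding single_conv_mon[symmetric]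
  by (rule poly_mapping_eqI) (simp add: lookup_sum lookup_single when_def in_keys_iff)

lemma homogeneous_part_sum:
  "(\<And>i. i \<in> S \<Longrightarrow> f i \<in> homogeneous_part d) \<Longrightarrow> (\<Sum>i\<in>S. f i) \<in> homogeneous_part d"
  using subspace_homogeneous_part by (rule cpoly.subspace_sum)

lemma homogeneous_part_one: "1 \<in> homogeneous_part 0"
  by (simp add: homogeneous_part_def expo_degree_def)

lemma homogeneous_part_pconst: "pconst c \<in> homogeneous_part 0"
  by (auto simp: homogeneous_part_def pconst_def expo_degree_def)

lemma homogeneous_part_pvar: "pvar j \<in> homogeneous_part 1"
  using mon_homogeneous[of "Poly_Mapping.single j 1"] by (simp add: pvar_def expo_degree_single)

lemma homogeneous_part_power: "p \<in> homogeneous_part d \<Longrightarrow> p ^ k \<in> homogeneous_part (k * d)"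
  by (induction k) (simp_all add: homogeneous_part_one homogeneous_part_mult)

lemma homogeneous_part_prod:
  "(\<And>i. i \<in> S \<Longrightarrow> f i \<in> homogeneous_part (d i)) \<Longrightarrow> (\<Prod>i\<in>S. f i) \<in> homogeneous_part (\<Sum>i\<in>S. d i)"
  by (induction S rule: infinite_finite_induct)
     (simp_all add: homogeneous_part_one homogeneous_part_mult)

lemma polys_in_one: "1 \<in> polys_in V"
  by (simp add: polys_in_def)

lemma polys_in_pconst: "pconst c \<in> polys_in V"
  by (auto simp: polys_in_def pconst_def)

lemma polys_in_pvar: "j \<in> V \<Longrightarrow> pvar j \<in> polys_in V"
  by (simp add: polys_in_def pvar_def)

lemma polys_in_mult:
  assumes "p \<in> polys_in V" "q \<in> polys_in V"
  shows "p * q \<in> polys_in V"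
proof -
  have "Poly_Mapping.keys t \<subseteq> V" if t: "t \<in> Poly_Mapping.keys (p * q)" for t
  proof -
    obtain a b where ab: "t = a + b" "a \<in> Poly_Mapping.keys p" "b \<in> Poly_Mapping.keys q"
      using keys_mult[of p q] t by blast
    have "Poly_Mapping.keys a \<union> Poly_Mapping.keys b \<subseteq> V"
      using ab assms by (auto simp: polys_in_def)
    then show ?thesis unfolding ab(1) using keys_add[of a b] by blast
  qed
  then show ?thesis by (simp add: polys_in_def)
qed

lemma subspace_polys_in: "cpoly.subspace (polys_in V)"
proof (rule cpoly.subspaceI)
  fix p q and c assume p: "p \<in> polys_in V"
  show "cscale c p \<in> polys_in V"
    unfolding cscale_def using p by (intro polys_in_mult polys_in_pconst)
  assume "q \<in> polys_in V"
  with p show "p + q \<in> polys_in V"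
    using keys_add[of p q] by (auto simp: polys_in_def)
qed (simp add: polys_in_def)

lemma polys_in_sum: "(\<And>i. i \<in> S \<Longrightarrow> f i \<in> polys_in V) \<Longrightarrow> (\<Sum>i\<in>S. f i) \<in> polys_in V"
  using subspace_polys_in by (rule cpoly.subspace_sum)

lemma polys_in_prod: "(\<And>i. i \<in> S \<Longrightarrow> f i \<in> polys_in V) \<Longrightarrow> (\<Prod>i\<in>S. f i) \<in> polys_in V"
  by (induction S rule: infinite_finite_induct) (simp_all add: polys_in_one polys_in_mult)

lemma polys_in_power: "p \<in> polys_in V \<Longrightarrow> p ^ k \<in> polys_in V"
  by (induction k) (simp_all add: polys_in_one polys_in_mult)

lemma linear_form_in_polys_in: "linear_form_in V p \<Longrightarrow> p \<in> polys_in V"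
  by (auto simp: linear_form_in_def intro!: polys_in_sum polys_in_mult polys_in_pconst polys_in_pvar)

lemma linear_form_in_homogeneous:
  assumes "linear_form_in V p"
  shows "p \<in> homogeneous_part 1"
proof -
  have "pconst c * pvar j \<in> homogeneous_part 1" for c and j :: 'a
    using homogeneous_part_mult[OF homogeneous_part_pconst homogeneous_part_pvar] by simp
  then show ?thesis
    using assms by (auto simp: linear_form_in_def intro!: homogeneous_part_sum)
qed

section \<open>Ideals of the subring, and congruence of products\<close>

lemma ideal_gen_in_zero: "0 \<in> ideal_gen_in V S"
  unfolding ideal_gen_in_def by (intro CollectI exI[of _ "{}"]) simp

lemma ideal_gen_in_base: "r \<in> polys_in V \<Longrightarrow> s \<in> S \<Longrightarrow> r * s \<in> ideal_gen_in V S"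
  unfolding ideal_gen_in_def by (intro CollectI exI[of _ "{s}"] exI[of _ "\<lambda>_. r"]) simp

lemma ideal_gen_in_add:
  assumes "p \<in> ideal_gen_in V S" "q \<in> ideal_gen_in V S"
  shows "p + q \<in> ideal_gen_in V S"
proof -
  obtain F r where F: "p = (\<Sum>s\<in>F. r s * s)" "finite F" "F \<subseteq> S" "\<forall>s\<in>F. r s \<in> polys_in V"
    using assms(1) unfolding ideal_gen_in_def by blast
  obtain F' r' where F': "q = (\<Sum>s\<in>F'. r' s * s)" "finite F'" "F' \<subseteq> S" "\<forall>s\<in>F'. r' s \<in> polys_in V"
    using assms(2) unfolding ideal_gen_in_def by blast
  \<comment> \<open>The multipliers are extended by 0 to the union of the two finite sets, which
    keeps them in \<open>polys_in V\<close>.\<close>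
  define t where "t s = (if s \<in> F then r s else 0) + (if s \<in> F' then r' s else 0)" for s
  have zero: "0 \<in> polys_in V" by (simp add: polys_in_def)
  have "p = (\<Sum>s\<in>F \<union> F'. (if s \<in> F then r s else 0) * s)"
    unfolding F(1) using F(2) F'(2) by (intro sum.mono_neutral_cong_left) auto
  moreover have "q = (\<Sum>s\<in>F \<union> F'. (if s \<in> F' then r' s else 0) * s)"
    unfolding F'(1) using F(2) F'(2) by (intro sum.mono_neutral_cong_left) auto
  ultimately have "p + q = (\<Sum>s\<in>F \<union> F'. t s * s)"
    by (simp add: t_def distrib_right sum.distrib)
  moreover have "t s \<in> polys_in V" for s
    unfolding t_def using F(4) F'(4) zero by (intro cpoly.subspace_add[OF subspace_polys_in]) auto
  ultimately show ?thesis
    unfolding ideal_gen_in_def using F F'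
    by (intro CollectI exI[of _ "F \<union> F'"] exI[of _ t]) simp
qed

lemma ideal_gen_in_cscale:
  assumes "p \<in> ideal_gen_in V S"
  shows "cscale c p \<in> ideal_gen_in V S"
proof -
  obtain F r where F: "p = (\<Sum>s\<in>F. r s * s)" "finite F" "F \<subseteq> S" "\<forall>s\<in>F. r s \<in> polys_in V"
    using assms(1) unfolding ideal_gen_in_def by blast
  have "cscale c p = (\<Sum>s\<in>F. (pconst c * r s) * s)"
    by (simp add: F(1) cscale_def sum_distrib_left mult.assoc)
  then show ?thesis
    unfolding ideal_gen_in_def using F
    by (intro CollectI exI[of _ F] exI[of _ "\<lambda>s. pconst c * r s"])
       (simp add: polys_in_mult polys_in_pconst)
qed

lemma ideal_gen_in_subset: "S \<subseteq> ideal_gen T \<Longrightarrow> ideal_gen_in V S \<subseteq> ideal_gen T"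
  unfolding ideal_gen_in_def by (auto intro!: ideal_gen_sum ideal_gen_mult)

lemma prod_power_congruence:
  assumes "\<And>j. a j - b j \<in> ideal_gen S"
  shows "(\<Prod>j\<in>J. a j ^ e j) - (\<Prod>j\<in>J. b j ^ e j) \<in> ideal_gen S"
proof -
  have mult: "p * q - p' * q' \<in> ideal_gen S"
    if "p - p' \<in> ideal_gen S" "q - q' \<in> ideal_gen S" for p p' q q'
  proof -
    have "p * q - p' * q' = p * (q - q') + q' * (p - p')" by (simp add: algebra_simps)
    then show ?thesis using that by (simp add: ideal_gen_add ideal_gen_mult)
  qed
  have power: "a j ^ k - b j ^ k \<in> ideal_gen S" for j k
    by (induction k) (simp_all add: ideal_gen_zero mult assms)
  show ?thesis
    by (induction J rule: infinite_finite_induct) (simp_all add: ideal_gen_zero mult power)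
qed

section \<open>Graded pieces of the apolar space\<close>

lemma subspace_perp_ideal_gen: "cpoly.subspace (perp (ideal_gen S))"
  by (rule cpoly.subspaceI)
     (auto simp: perp_ideal_gen_iff mpair_zero_right mpair_add_right mpair_cscale_right)

lemma homogeneous_part_span:
  "homogeneous_part q \<subseteq> cpoly.span (mon ` {u :: 'n::finite expo. expo_degree u = q})"
proof
  fix p :: "'n mpoly" assume "p \<in> homogeneous_part q"
  then have "(\<Sum>u\<in>Poly_Mapping.keys p. cscale (Poly_Mapping.lookup p u) (mon u))
      \<in> cpoly.span (mon ` {u. expo_degree u = q})"
    by (intro cpoly.span_sum cpoly.span_scale cpoly.span_base) (auto simp: homogeneous_part_def)
  then show "p \<in> cpoly.span (mon ` {u. expo_degree u = q})"
    by (simp add: cscale_def sum_pconst_mon)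
qed

text \<open>The apolar space is graded, because taking components is self-adjoint for the pairing
  and the ideal is graded. Bases of the pieces up to degree \<open>N\<close> therefore unite to a
  basis.\<close>

lemma dim_perp_eq_sum:
  fixes S :: "'n::finite mpoly set"
  defines "P \<equiv> perp (ideal_gen S)"
  assumes hom: "\<And>s. s \<in> S \<Longrightarrow> \<exists>d. s \<in> homogeneous_part d"
    and top: "\<And>q. q > N \<Longrightarrow> homogeneous_part q \<subseteq> ideal_gen S"
  shows "cpoly.dim P = (\<Sum>q\<le>N. cpoly.dim (P \<inter> homogeneous_part q))"
proof -
  have "\<exists>B \<subseteq> P \<inter> homogeneous_part q. cpoly.independent B \<and> P \<inter> homogeneous_part q \<subseteq> cpoly.span B \<and>
      card B = cpoly.dim (P \<inter> homogeneous_part q)" for q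
    using cpoly.basis_exists[of "P \<inter> homogeneous_part q"] by metis
  then obtain B where B: "\<And>q. B q \<subseteq> P \<inter> homogeneous_part q" "\<And>q. cpoly.independent (B q)"
    "\<And>q. P \<inter> homogeneous_part q \<subseteq> cpoly.span (B q)"
    "\<And>q. card (B q) = cpoly.dim (P \<inter> homogeneous_part q)"
    by metis
  have fin: "finite (B q)" for q
    using cpoly.independent_span_bound[of "mon ` {u. expo_degree u = q}" "B q"]
      B(1)[of q] B(2)[of q] homogeneous_part_span[of q] finite_expo_degree[of q] by blast
  have hB: "b \<in> homogeneous_part q" if "b \<in> B q" for b q
    using B(1) that by blast
  have disj: "B q \<inter> B q' = {}" if "q \<noteq> q'" for q q'
  proof (rule ccontr)
    assume "B q \<inter> B q' \<noteq> {}"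
    then obtain b where b: "b \<in> B q" "b \<in> B q'" by blast
    have "b = 0"
      using hcomp_of_homogeneous[OF hB[OF b(1)], of q] hcomp_of_homogeneous[OF hB[OF b(2)], of q] that
      by simp
    then show False using b(1) B(2)[of q] cpoly.dependent_zero by blast
  qed
  define U where "U = (\<Union>q\<le>N. B q)"
  have finU: "finite U" using fin by (simp add: U_def)
  have "cpoly.independent U"
  proof (rule cpoly.independent_if_scalars_zero[OF finU])
    fix f x assume f: "(\<Sum>x\<in>U. cscale (f x) x) = 0" and "x \<in> U"
    then obtain q where q: "q \<le> N" "x \<in> B q" by (auto simp: U_def)
    have "(\<Sum>q'\<le>N. \<Sum>x\<in>B q'. cscale (f x) x) = 0"
      using f disj fin unfolding U_def by (subst (asm) sum.UNION_disjoint) auto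
    \<comment> \<open>Projecting the relation to degree \<open>q\<close> isolates the part inside
      the basis \<open>B q\<close>.\<close>
    then have "0 = hcomp q (\<Sum>q'\<le>N. \<Sum>x\<in>B q'. cscale (f x) x)" by (simp add: hcomp_zero)
    also have "\<dots> = (\<Sum>q'\<le>N. if q' = q then \<Sum>x\<in>B q'. cscale (f x) x else 0)"
      unfolding hcomp_sum[of q _ "{..N}"]
    proof (rule sum.cong[OF refl])
      fix q'
      have "(\<Sum>x\<in>B q'. cscale (f x) x) \<in> homogeneous_part q'"
        by (rule homogeneous_part_sum)
           (rule cpoly.subspace_scale[OF subspace_homogeneous_part hB])
      then show "hcomp q (\<Sum>x\<in>B q'. cscale (f x) x) = (if q' = q then \<Sum>x\<in>B q'. cscale (f x) x else 0)"
        by (rule hcomp_of_homogeneous)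
    qed
    also have "\<dots> = (\<Sum>x\<in>B q. cscale (f x) x)" using q(1) by simp
    finally have "(\<Sum>x\<in>B q. cscale (f x) x) = 0" ..
    then show "f x = 0"
      using B(2)[of q] fin q(2) unfolding cpoly.independent_explicit_finite_subsets by blast
  qed
  moreover have "U \<subseteq> P" using B(1) by (auto simp: U_def)
  moreover have "P \<subseteq> cpoly.span U"
  proof
    fix f assume f: "f \<in> P"
    have comp: "hcomp q f \<in> P" for q
      using f hcomp_ideal_gen[OF hom] unfolding P_def by (simp add: perp_ideal_gen_iff mpair_hcomp)
    have high: "hcomp q f = 0" if "q > N" for q
    proof (rule poly_mapping_eqI)
      fix u
      show "Poly_Mapping.lookup (hcomp q f) u = Poly_Mapping.lookup 0 u"
      proof (cases "expo_degree u = q")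
        case True
        then have "mon u \<in> ideal_gen S" using top[OF that] mon_homogeneous[of u] by auto
        then have "mpair (mon u) f = 0" using f unfolding P_def perp_ideal_gen_iff by blast
        then show ?thesis by (simp add: lookup_hcomp mpair_mon_left expo_fact_nonzero)
      qed (simp add: lookup_hcomp)
    qed
    have "f = (\<Sum>q\<le>N. hcomp q f)"
    proof (rule poly_mapping_eqI)
      fix u
      have "Poly_Mapping.lookup f u = 0" if "\<not> expo_degree u \<le> N"
        using lookup_hcomp[of "expo_degree u" f u] high[of "expo_degree u"] that by simp
      then show "Poly_Mapping.lookup f u = Poly_Mapping.lookup (\<Sum>q\<le>N. hcomp q f) u"
        by (auto simp: lookup_sum lookup_hcomp)
    qed
    also have "\<dots> \<in> cpoly.span U"
    proof (rule cpoly.span_sum)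
      fix q assume "q \<in> {..N}"
      then have "B q \<subseteq> U" by (auto simp: U_def)
      then show "hcomp q f \<in> cpoly.span U"
        using comp hcomp_homogeneous[of q f] B(3)[of q] cpoly.span_mono[of "B q" U] by blast
    qed
    finally show "f \<in> cpoly.span U" .
  qed
  ultimately have "cpoly.dim P = card U" by (metis cpoly.basis_card_eq_dim)
  also have "\<dots> = (\<Sum>q\<le>N. card (B q))"
    unfolding U_def using fin disj by (intro card_UN_disjoint) auto
  finally show ?thesis by (simp add: B(4))
qed

text \<open>\<open>dim\<close> is the cardinality of a basis, which would be 0 for an infinite basis
  too; containment in a homogeneous part forces finiteness.\<close>

lemma dim_eq_0_iff_trivial:
  assumes V: "cpoly.subspace V" "V \<subseteq> homogeneous_part q"
  shows "cpoly.dim V = 0 \<longleftrightarrow> V = {0}"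
proof
  assume dim: "cpoly.dim V = 0"
  obtain B where B: "B \<subseteq> V" "cpoly.independent B" "V \<subseteq> cpoly.span B" "card B = cpoly.dim V"
    by (rule cpoly.basis_exists)
  have "finite B"
    using cpoly.independent_span_bound[of "mon ` {u. expo_degree u = q}" B]
      B(1,2) V(2) homogeneous_part_span[of q] finite_expo_degree[of q] by blast
  then have "B = {}" using B(4) dim by simp
  then show "V = {0}" using B(3) cpoly.subspace_0[OF V(1)] by auto
next
  assume "V = {0}"
  then have "cpoly.span {} = cpoly.span V" by (simp add: cpoly.span_insert_0[of "{}"])
  from cpoly.dim_eq_card[OF this] show "cpoly.dim V = 0" by (simp add: cpoly.independent_empty)
qed

section \<open>Elimination of the variables in the negative support\<close>

locale fake_exponent_setting = toric_groebner A w m gp gm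
  for A :: "int ^ 'n::finite ^ 'd::finite" and w :: "real ^ 'n"
    and m :: nat and gp gm :: "nat \<Rightarrow> 'n expo" +
  fixes \<beta> :: "complex ^ 'd" and v :: "complex ^ 'n"
    and L :: "'n \<Rightarrow> 'n mpoly" and ell :: "nat \<Rightarrow> 'n mpoly"
    and ells :: "'n mpoly set"
  assumes fake: "fake_exponent A \<beta> w v"
    and row_red: "row_reduction A (nsupp v) L ell"
    and ells_eq: "ells = ell ` {1..CARD('d) - card (nsupp v)}"
begin

abbreviation "G i \<equiv> G_set v (gp i) (gm i)"
abbreviation "V \<equiv> - nsupp v"
abbreviation "Q \<equiv> Q_ideal A v m gp gm"
abbreviation "J \<equiv> link_quotient_ideal A w v ell"
abbreviation "nonfaces \<equiv> {(\<Prod>i\<in>\<tau>. pvar i) | \<tau>. \<tau> \<subseteq> V \<and> \<tau> \<notin> link_complex A w v}"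

text \<open>Generators of \<open>Q\<close> after row reduction; each is homogeneous and, apart from
  the eliminating forms, involves only variables in \<open>V\<close>.\<close>

definition gens :: "'n mpoly set" where
  "gens = (\<lambda>i. pvar i - L i) ` nsupp v \<union> ells \<union> (\<lambda>i. \<Prod>j\<in>G i. pvar j) ` {1..m}"

lemma L_linear: "i \<in> nsupp v \<Longrightarrow> linear_form_in V (L i)"
  and ell_linear: "s \<in> ells \<Longrightarrow> linear_form_in V s"
  and rows_eq: "ideal_gen ((\<lambda>i. pvar i - L i) ` nsupp v \<union> ells) = ideal_gen (range (row_form A))"
  using row_red by (auto simp: row_reduction_def ells_eq)

lemma Q_eq: "Q = ideal_gen gens"
  unfolding Q_ideal_def M_ideal_def gens_def rows_eq[symmetric] ideal_sum_ideal_gen ..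

lemma rows_subset_Q: "ideal_gen (range (row_form A)) \<subseteq> Q"
  unfolding Q_eq rows_eq[symmetric] gens_def
  by (rule ideal_gen_subset) (auto intro: ideal_gen_base)

lemma gens_homogeneous: "s \<in> gens \<Longrightarrow> \<exists>d. s \<in> homogeneous_part d"
  unfolding gens_def
proof (elim UnE imageE)
  fix i assume "i \<in> nsupp v" "s = pvar i - L i"
  then show ?thesis
    using cpoly.subspace_diff[OF subspace_homogeneous_part homogeneous_part_pvar
        linear_form_in_homogeneous[OF L_linear]] by blast
next
  assume "s \<in> ells"
  then show ?thesis using linear_form_in_homogeneous[OF ell_linear] by blast
next
  fix i assume "s = (\<Prod>j\<in>G i. pvar j)"
  then show ?thesis unfolding prod_pvar using mon_homogeneous by blast
qed

lemma gens_in_Q: "s \<in> gens \<Longrightarrow> s \<in> Q"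
  unfolding Q_eq by (rule ideal_gen_base)

lemma prod_pvar_in_Q:
  assumes "\<tau> \<subseteq> V" and "\<tau> \<notin> link_complex A w v"
  shows "(\<Prod>j\<in>\<tau>. pvar j) \<in> Q"
proof -
  obtain i where i: "i \<in> {1..m}" "G i \<subseteq> \<tau>"
    using assms link_complex_iff by blast
  then have "(\<Prod>j\<in>\<tau>. pvar j) = (\<Prod>j\<in>\<tau> - G i. pvar j) * (\<Prod>j\<in>G i. pvar j :: 'n mpoly)"
    by (intro prod.subset_diff) auto
  moreover have "(\<Prod>j\<in>G i. pvar j) \<in> Q" using i(1) by (intro gens_in_Q) (auto simp: gens_def)
  ultimately show ?thesis unfolding Q_eq by (simp add: ideal_gen_mult)
qed

section \<open>The ideal defining the quotient algebra of the link\<close>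

lemma J_eq: "J = {p + q | p q. p \<in> ideal_gen_in V nonfaces \<and> q \<in> ideal_gen_in V ells}"
  unfolding link_quotient_ideal_def ideal_sum_def stanley_reisner_ideal_def ells_eq ..

lemma J_zero: "0 \<in> J"
  unfolding J_eq
  by (intro CollectI exI[of _ 0] conjI ideal_gen_in_zero) simp

lemma J_add:
  assumes "p \<in> J" "q \<in> J"
  shows "p + q \<in> J"
proof -
  obtain a b where ab: "p = a + b" "a \<in> ideal_gen_in V nonfaces" "b \<in> ideal_gen_in V ells"
    using assms(1) unfolding J_eq by blast
  obtain a' b' where ab': "q = a' + b'" "a' \<in> ideal_gen_in V nonfaces" "b' \<in> ideal_gen_in V ells"
    using assms(2) unfolding J_eq by blast
  have "p + q = (a + a') + (b + b')" by (simp add: ab ab')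
  then show ?thesis
    unfolding J_eq
    using ideal_gen_in_add[OF ab(2) ab'(2)] ideal_gen_in_add[OF ab(3) ab'(3)] by blast
qed

lemma J_base:
  assumes r: "r \<in> polys_in V" and s: "s \<in> nonfaces \<union> ells"
  shows "r * s \<in> J"
proof -
  have "\<exists>a b. r * s = a + b \<and> a \<in> ideal_gen_in V nonfaces \<and> b \<in> ideal_gen_in V ells"
    using s
  proof
    assume "s \<in> nonfaces"
    then show ?thesis
      using ideal_gen_in_base[OF r] ideal_gen_in_zero
      by (intro exI[of _ "r * s"] exI[of _ 0] conjI) simp_all
  next
    assume "s \<in> ells"
    then show ?thesis
      using ideal_gen_in_base[OF r] ideal_gen_in_zero
      by (intro exI[of _ 0] exI[of _ "r * s"] conjI) simp_all
  qed
  then show ?thesis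
    unfolding J_eq by blast
qed

lemma subspace_J: "cpoly.subspace J"
proof (rule cpoly.subspaceI)
  fix c p assume "p \<in> J"
  then obtain a b where ab: "p = a + b" "a \<in> ideal_gen_in V nonfaces" "b \<in> ideal_gen_in V ells"
    unfolding J_eq by blast
  have "cscale c p = cscale c a + cscale c b" by (simp add: ab(1) cpoly.scale_right_distrib)
  then show "cscale c p \<in> J"
    unfolding J_eq
    using ideal_gen_in_cscale[OF ab(2), of c] ideal_gen_in_cscale[OF ab(3), of c] by blast
qed (simp_all add: J_zero J_add)

lemma J_subset_Q: "J \<subseteq> Q"
proof -
  have "nonfaces \<subseteq> Q" using prod_pvar_in_Q by blast
  then have "ideal_gen_in V nonfaces \<subseteq> Q" unfolding Q_eq by (rule ideal_gen_in_subset)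
  moreover have "ells \<subseteq> Q" using gens_in_Q by (auto simp: gens_def)
  then have "ideal_gen_in V ells \<subseteq> Q" unfolding Q_eq by (rule ideal_gen_in_subset)
  ultimately show ?thesis
    unfolding J_eq
    using ideal_gen_add[where S = gens] unfolding Q_eq by blast
qed

text \<open>The substitution by these images is a retraction onto the polynomials in
  \<open>V\<close> that preserves degrees and, modulo \<open>Q\<close>, is the identity.\<close>

definition image_of_var :: "'n \<Rightarrow> 'n mpoly" where
  "image_of_var j = (if j \<in> nsupp v then L j else pvar j)"

abbreviation elim_vars :: "'n mpoly \<Rightarrow> 'n mpoly" where
  "elim_vars \<equiv> mpoly_hom pconst image_of_var"

lemma image_of_var_polys_in: "image_of_var j \<in> polys_in V"
  by (simp add: image_of_var_def linear_form_in_polys_in L_linear polys_in_pvar)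

lemma image_of_var_homogeneous: "image_of_var j \<in> homogeneous_part 1"
  by (simp add: image_of_var_def linear_form_in_homogeneous[OF L_linear] homogeneous_part_pvar
      del: One_nat_def)

lemma elim_vars_polys_in: "elim_vars p \<in> polys_in V"
  unfolding mpoly_hom_def
  by (intro polys_in_sum polys_in_mult polys_in_pconst polys_in_prod polys_in_power
      image_of_var_polys_in)

lemma elim_vars_homogeneous:
  assumes "p \<in> homogeneous_part q"
  shows "elim_vars p \<in> homogeneous_part q"
  unfolding mpoly_hom_def
proof (rule homogeneous_part_sum)
  fix u assume "u \<in> Poly_Mapping.keys p"
  then have "expo_degree u = q" using assms by (simp add: homogeneous_part_def)
  moreover have "(\<Prod>j\<in>UNIV. image_of_var j ^ Poly_Mapping.lookup u j)
      \<in> homogeneous_part (\<Sum>j\<in>UNIV. Poly_Mapping.lookup u j * 1)"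
    by (intro homogeneous_part_prod homogeneous_part_power image_of_var_homogeneous)
  ultimately have "(\<Prod>j\<in>UNIV. image_of_var j ^ Poly_Mapping.lookup u j) \<in> homogeneous_part q"
    by (simp add: expo_degree_def)
  from homogeneous_part_mult[OF homogeneous_part_pconst this]
  show "pconst (Poly_Mapping.lookup p u) * (\<Prod>j\<in>UNIV. image_of_var j ^ Poly_Mapping.lookup u j)
      \<in> homogeneous_part q" by simp
qed

lemma elim_vars_id:
  assumes "p \<in> polys_in V"
  shows "elim_vars p = p"
proof -
  have "elim_vars p = (\<Sum>u\<in>Poly_Mapping.keys p. pconst (Poly_Mapping.lookup p u) * mon u)"
    unfolding mpoly_hom_def
  proof (rule sum.cong[OF refl])
    fix u assume "u \<in> Poly_Mapping.keys p"
    then have u: "Poly_Mapping.keys u \<subseteq> V" using assms by (simp add: polys_in_def)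
    have "(\<Prod>j\<in>UNIV. image_of_var j ^ Poly_Mapping.lookup u j)
        = (\<Prod>j\<in>UNIV. pvar j ^ Poly_Mapping.lookup u j)"
    proof (rule prod.cong[OF refl])
      fix j
      show "image_of_var j ^ Poly_Mapping.lookup u j = pvar j ^ Poly_Mapping.lookup u j"
      proof (cases "j \<in> nsupp v")
        case True
        then have "Poly_Mapping.lookup u j = 0" using u not_in_keys_iff_lookup_eq_zero by fastforce
        then show ?thesis by simp
      qed (simp add: image_of_var_def)
    qed
    then show "pconst (Poly_Mapping.lookup p u) * (\<Prod>j\<in>UNIV. image_of_var j ^ Poly_Mapping.lookup u j)
        = pconst (Poly_Mapping.lookup p u) * mon u"
      by (simp add: prod_pvar_power)
  qed
  then show ?thesis by (simp add: sum_pconst_mon)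
qed

lemma elim_vars_congruent: "p - elim_vars p \<in> Q"
proof -
  have var: "pvar j - image_of_var j \<in> ideal_gen gens" for j
    by (auto simp: image_of_var_def gens_def ideal_gen_zero intro: ideal_gen_base)
  have "p - elim_vars p = (\<Sum>u\<in>Poly_Mapping.keys p. pconst (Poly_Mapping.lookup p u) *
      ((\<Prod>j\<in>UNIV. pvar j ^ Poly_Mapping.lookup u j) - (\<Prod>j\<in>UNIV. image_of_var j ^ Poly_Mapping.lookup u j)))"
    unfolding right_diff_distrib sum_subtractf prod_pvar_power sum_pconst_mon
    by (simp add: mpoly_hom_def)
  also have "\<dots> \<in> ideal_gen gens"
    by (intro ideal_gen_sum ideal_gen_mult prod_power_congruence var)
  finally show ?thesis unfolding Q_eq .
qed

text \<open>Eliminating forms are sent to 0; the remaining generators are fixed and generate inside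
  \<open>J\<close>, since each \<open>G i\<close> is a nonface of the link.\<close>

lemma elim_vars_Q:
  assumes "p \<in> Q"
  shows "elim_vars p \<in> J"
  using assms unfolding Q_eq
proof (induction rule: ideal_gen_induct)
  case zero
  show ?case by (simp add: subst_hom.hom_zero J_zero)
next
  case (step r s p)
  have "elim_vars r * elim_vars s \<in> J"
    using step.hyps unfolding gens_def
  proof (elim UnE imageE)
    fix i assume i: "i \<in> nsupp v" "s = pvar i - L i"
    then have "elim_vars s = 0"
      by (simp add: subst_hom.hom_diff subst_hom.hom_pvar image_of_var_def elim_vars_id
          linear_form_in_polys_in[OF L_linear])
    then show ?thesis by (simp add: J_zero)
  next
    assume "s \<in> ells"
    then show ?thesis
      by (simp add: elim_vars_id linear_form_in_polys_in[OF ell_linear] J_base elim_vars_polys_in)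
  next
    fix i assume i: "i \<in> {1..m}" "s = (\<Prod>j\<in>G i. pvar j)"
    have GV: "G i \<subseteq> V" by (rule G_set_disjoint_nsupp)
    then have "s \<in> polys_in V" unfolding i(2) by (intro polys_in_prod polys_in_pvar) blast
    moreover have "G i \<notin> link_complex A w v" using link_complex_iff[OF GV] i(1) by blast
    then have "s \<in> nonfaces" using GV i(2) by blast
    ultimately show ?thesis by (simp add: elim_vars_id J_base elim_vars_polys_in)
  qed
  then show ?case using step.IH by (simp add: subst_hom.hom_add subst_hom.hom_mult J_add)
qed

text \<open>A polynomial in \<open>V\<close> is fixed by the substitution, which maps
  \<open>Q\<close> into \<open>J\<close>; so \<open>J\<close> is the contraction of \<open>Q\<close>
  to the subring.\<close>

lemma J_iff_Q: "p \<in> polys_in V \<Longrightarrow> p \<in> J \<longleftrightarrow> p \<in> Q"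
  using J_subset_Q elim_vars_Q[of p] by (auto simp: elim_vars_id)

lemma dim_perp_eq_quot_dim:
  "cpoly.dim (perp Q \<inter> homogeneous_part q) = quot_dim (polys_in V \<inter> homogeneous_part q) J"
proof -
  let ?W = "polys_in V \<inter> homogeneous_part q"
  have W: "cpoly.subspace ?W"
    by (rule cpoly.subspace_inter[OF subspace_polys_in subspace_homogeneous_part])
  let ?E = "{u. expo_degree u = q \<and> Poly_Mapping.keys u \<subseteq> V}"
  have "?W \<subseteq> cpoly.span (mon ` ?E)"
  proof
    fix p assume "p \<in> ?W"
    then have "(\<Sum>u\<in>Poly_Mapping.keys p. cscale (Poly_Mapping.lookup p u) (mon u)) \<in> cpoly.span (mon ` ?E)"
      by (intro cpoly.span_sum cpoly.span_scale cpoly.span_base)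
         (auto simp: homogeneous_part_def polys_in_def)
    then show "p \<in> cpoly.span (mon ` ?E)" by (simp add: cscale_def sum_pconst_mon)
  qed
  moreover have "mon ` ?E \<subseteq> ?W" by (auto simp: homogeneous_part_def polys_in_def)
  moreover have "finite ?E" using finite_expo_degree[of q] by (rule rev_finite_subset) blast
  ultimately obtain B where B: "quot_basis ?W J B"
    using quot_basis_exists[OF _ _ _ subspace_J, of "mon ` ?E" ?W] by blast
  \<comment> \<open>Stated for an arbitrary basis \<open>B'\<close>, since this also shows that all
    bases of the quotient have the same size.\<close>
  have "cpoly.dim (perp Q \<inter> homogeneous_part q) = card B'" if "quot_basis ?W J B'" for B'
    unfolding Q_eq
  proof (rule dim_perp_homogeneous[OF gens_homogeneous _ W _ _ that])
    show "\<exists>p'\<in>?W. p - p' \<in> ideal_gen gens" if "p \<in> homogeneous_part q" for p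
      using that elim_vars_congruent[of p] elim_vars_polys_in elim_vars_homogeneous
      unfolding Q_eq by blast
    show "p \<in> J \<longleftrightarrow> p \<in> ideal_gen gens" if "p \<in> ?W" for p
      using that J_iff_Q unfolding Q_eq by blast
  qed auto
  then show ?thesis using quot_dim_eqI[OF B] by metis
qed

text \<open>Modulo the rows, a repeated variable can be traded for variables outside the support,
  so that the support grows until it is no longer a face.\<close>

lemma mon_in_Q: "CARD('n) < expo_degree u \<Longrightarrow> mon u \<in> Q"
proof (induction "CARD('n) - card (Poly_Mapping.keys u \<union> nsupp v)" arbitrary: u rule: less_induct)
  case less
  let ?\<tau> = "Poly_Mapping.keys u - nsupp v"
  show ?case
  proof (cases "?\<tau> \<in> link_complex A w v")
    case False
    \<comment> \<open>The exponent of the squarefree monomial on \<open>?\<tau>\<close>; it divides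
      \<open>mon u\<close> and lies in \<open>Q\<close> because \<open>?\<tau>\<close> is a
      nonface.\<close>
    define e where "e = (\<Sum>j\<in>?\<tau>. Poly_Mapping.single j (1::nat))"
    have lookup_e: "Poly_Mapping.lookup e k = (if k \<in> ?\<tau> then 1 else 0)" for k
      by (simp add: e_def lookup_sum lookup_single when_def)
    have "u = (u - e) + e"
      by (rule poly_mapping_eqI) (auto simp: lookup_add lookup_minus lookup_e in_keys_iff)
    then have "mon u = mon (u - e) * (\<Prod>j\<in>?\<tau>. pvar j)"
      by (simp only: prod_pvar mon_mult flip: e_def)
    moreover have "(\<Prod>j\<in>?\<tau>. pvar j) \<in> Q" using False by (intro prod_pvar_in_Q) auto
    ultimately show ?thesis unfolding Q_eq by (simp add: ideal_gen_mult)
  next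
    case True
    \<comment> \<open>Pigeonhole: the degree exceeds the number of variables.\<close>
    have "\<exists>j. Poly_Mapping.lookup u j \<ge> 2"
    proof (rule ccontr)
      assume "\<not> ?thesis"
      then have "Poly_Mapping.lookup u j \<le> 1" for j
        by (metis Suc_1 not_less_eq_eq)
      then have "expo_degree u \<le> (\<Sum>j\<in>(UNIV :: 'n set). 1)"
        unfolding expo_degree_def by (intro sum_mono) simp
      with less.prems show False by simp
    qed
    then obtain j where j: "Poly_Mapping.lookup u j \<ge> 2" ..
    then have "j \<in> Poly_Mapping.keys u" by (simp add: in_keys_iff)
    then obtain c where c: "pvar j + (\<Sum>k\<in>- (?\<tau> \<union> nsupp v). pconst (c k) * pvar k)
        \<in> ideal_gen (range (row_form A))"
      using link_face_form[OF True, of j] by auto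
    \<comment> \<open>Since the exponent of \<open>j\<close> is at least 2, removing one copy leaves
      the support unchanged, so trading it for \<open>k\<close> enlarges the support by exactly one
      variable.\<close>
    define u' where "u' = u - Poly_Mapping.single j 1"
    have u: "u = u' + Poly_Mapping.single j 1"
      using j by (intro poly_mapping_eqI) (auto simp: u'_def lookup_add lookup_minus lookup_single when_def)
    have IH: "mon (u' + Poly_Mapping.single k 1) \<in> Q" if k: "k \<in> - (?\<tau> \<union> nsupp v)" for k
    proof (rule less.hyps)
      let ?t = "u' + Poly_Mapping.single k 1"
      show "CARD('n) < expo_degree ?t"
        using less.prems by (simp add: u expo_degree_add expo_degree_single)
      have lookup_t: "Poly_Mapping.lookup ?t i \<noteq> 0 \<longleftrightarrow> i = k \<or> Poly_Mapping.lookup u i \<noteq> 0" for i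
        using j by (auto simp: u'_def lookup_add lookup_minus lookup_single when_def)
      have keys: "Poly_Mapping.keys ?t = insert k (Poly_Mapping.keys u)"
        unfolding set_eq_iff in_keys_iff lookup_t insert_iff by simp
      have "k \<notin> Poly_Mapping.keys u \<union> nsupp v" using k by blast
      then have "card (Poly_Mapping.keys ?t \<union> nsupp v) = Suc (card (Poly_Mapping.keys u \<union> nsupp v))"
        unfolding keys by simp
      moreover have "card (Poly_Mapping.keys ?t \<union> nsupp v) \<le> CARD('n)"
        by (rule card_mono) simp_all
      ultimately show "CARD('n) - card (Poly_Mapping.keys ?t \<union> nsupp v)
          < CARD('n) - card (Poly_Mapping.keys u \<union> nsupp v)"
        by linarith
    qed
    have "mon u = mon u' * (pvar j + (\<Sum>k\<in>- (?\<tau> \<union> nsupp v). pconst (c k) * pvar k))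
        - (\<Sum>k\<in>- (?\<tau> \<union> nsupp v). pconst (c k) * mon (u' + Poly_Mapping.single k 1))"
      unfolding u mon_mult[symmetric] pvar_def[symmetric]
      by (simp add: distrib_left sum_distrib_left mult.left_commute)
    also have "\<dots> \<in> ideal_gen gens"
      using c rows_subset_Q IH unfolding Q_eq
      by (intro ideal_gen_diff ideal_gen_sum ideal_gen_mult) auto
    finally show ?thesis unfolding Q_eq .
  qed
qed

lemma homogeneous_part_subset_Q:
  assumes "CARD('n) < q"
  shows "homogeneous_part q \<subseteq> Q"
proof
  fix p :: "'n mpoly" assume "p \<in> homogeneous_part q"
  then have "mon u \<in> ideal_gen gens" if "u \<in> Poly_Mapping.keys p" for u
    using mon_in_Q[of u] assms that by (auto simp: homogeneous_part_def Q_eq)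
  then have "(\<Sum>u\<in>Poly_Mapping.keys p. pconst (Poly_Mapping.lookup p u) * mon u) \<in> ideal_gen gens"
    by (intro ideal_gen_sum ideal_gen_mult)
  then show "p \<in> Q" by (simp add: sum_pconst_mon Q_eq)
qed

lemma perp_homogeneous_eq_0:
  assumes "CARD('n) < q"
  shows "perp Q \<inter> homogeneous_part q = {0}"
proof -
  have "f = 0" if f: "f \<in> perp Q" "f \<in> homogeneous_part q" for f
  proof (rule poly_mapping_eqI)
    fix u
    show "Poly_Mapping.lookup f u = Poly_Mapping.lookup 0 u"
    proof (cases "expo_degree u = q")
      case True
      then have "mon u \<in> Q" using homogeneous_part_subset_Q[OF assms] mon_homogeneous[of u] by auto
      then have "mpair (mon u) f = 0" using f(1) unfolding Q_eq perp_ideal_gen_iff by blast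
      then show ?thesis by (simp add: mpair_mon_left expo_fact_nonzero)
    next
      case False
      then show ?thesis using f(2) by (auto simp: homogeneous_part_def in_keys_iff)
    qed
  qed
  moreover have "0 \<in> perp Q" "0 \<in> homogeneous_part q"
    unfolding Q_eq by (simp_all add: cpoly.subspace_0 subspace_perp_ideal_gen subspace_homogeneous_part)
  ultimately show ?thesis by blast
qed

text \<open>Pairing with 1 is evaluation at the origin. All generators vanish there: the linear ones
  have no constant term, and each monomial is a product over a nonempty set.\<close>

lemma one_in_perp_Q: "1 \<in> perp Q"
proof -
  define ev where "ev = mpoly_hom (\<lambda>x. x) (\<lambda>j::'n. 0::complex)"
  have ev_linear: "ev p = 0" if "linear_form_in S p" for S p
    using that by (auto simp: ev_def linear_form_in_def eval_hom.hom_sum eval_hom.hom_mult eval_hom.hom_pvar)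
  have gen0: "ev s = 0" if "s \<in> gens" for s
    using that unfolding gens_def
  proof (elim UnE imageE)
    fix i assume "i \<in> nsupp v" "s = pvar i - L i"
    then show ?thesis
      using ev_linear[OF L_linear] by (simp add: ev_def eval_hom.hom_diff eval_hom.hom_pvar)
  next
    assume "s \<in> ells"
    then show ?thesis using ev_linear[OF ell_linear] by blast
  next
    fix i assume i: "i \<in> {1..m}" "s = (\<Prod>j\<in>G i. pvar j)"
    then obtain j where "j \<in> G i" using G_set_nonempty[OF fake] by blast
    then show ?thesis
      unfolding i(2) ev_def by (auto simp: eval_hom.hom_prod eval_hom.hom_pvar card_gt_0_iff)
  qed
  have "ev \<phi> = 0" if "\<phi> \<in> ideal_gen gens" for \<phi>
    using that
    by (induction rule: ideal_gen_induct)
       (use gen0 in \<open>auto simp: ev_def eval_hom.hom_zero eval_hom.hom_add eval_hom.hom_mult\<close>)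
  moreover have "ev \<phi> = mpair \<phi> 1" for \<phi>
  proof (induction \<phi> rule: poly_mapping_add_induct)
    case (single u c)
    have "mpair (Poly_Mapping.single u c) (Poly_Mapping.single 0 1) = (if u = 0 then c else 0)"
      by (simp only: mpair_single_right) (simp add: lookup_single when_def expo_fact_def)
    moreover have "(\<Prod>j\<in>UNIV. 0 ^ Poly_Mapping.lookup u j) = (if u = 0 then 1 else (0::complex))"
    proof (cases "u = 0")
      case False
      then obtain j where "Poly_Mapping.lookup u j \<noteq> 0"
        by (metis lookup_zero poly_mapping_eqI)
      then have "(\<Prod>j\<in>UNIV. 0 ^ Poly_Mapping.lookup u j) = (0::complex)"
        by (intro prod_zero) (auto intro!: exI[of _ j])
      then show ?thesis using False by simp
    qed simp
    ultimately show ?case by (simp add: ev_def eval_hom.hom_single)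
  qed (simp add: ev_def eval_hom.hom_add mpair_add_left)
  ultimately show ?thesis unfolding Q_eq perp_ideal_gen_iff by simp
qed

section \<open>Hilbert series, degree and rank\<close>

lemma dim_perp_eq_0_iff:
  "cpoly.dim (perp Q \<inter> homogeneous_part q) = 0 \<longleftrightarrow> perp Q \<inter> homogeneous_part q = {0}"
  unfolding Q_eq
  by (rule dim_eq_0_iff_trivial[of _ q])
     (simp_all add: cpoly.subspace_inter subspace_perp_ideal_gen subspace_homogeneous_part)

lemma H_series_eq:
  "Abs_fps (\<lambda>q. int (cpoly.dim (perp Q \<inter> homogeneous_part q))) = H_series A w v ell"
  by (simp add: H_series_def hilbert_series_def dim_perp_eq_quot_dim)

text \<open>Stopping the sum at \<open>CARD('n)\<close> loses nothing, because the apolar space is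
  trivial in all higher degrees.\<close>

lemma coeff_dim_poly:
  "coeff (\<Sum>q\<le>CARD('n). monom (int (cpoly.dim (perp Q \<inter> homogeneous_part q))) q) k
     = int (cpoly.dim (perp Q \<inter> homogeneous_part k))"
proof -
  define h where "h q = cpoly.dim (perp Q \<inter> homogeneous_part q)" for q
  have "h k = 0" if "\<not> k \<le> CARD('n)"
    unfolding h_def dim_perp_eq_0_iff using that by (intro perp_homogeneous_eq_0) simp
  then show ?thesis
    unfolding h_def[symmetric] by (simp add: coeff_sum)
qed

lemma H_poly_eq:
  "H_poly A w v ell = (\<Sum>q\<le>CARD('n). monom (int (cpoly.dim (perp Q \<inter> homogeneous_part q))) q)"
  (is "_ = ?p")
proof -
  have H: "fps_of_poly ?p = H_series A w v ell"
    unfolding H_series_eq[symmetric] by (intro fps_ext) (simp add: coeff_dim_poly)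
  show ?thesis
    unfolding H_poly_def
  proof (rule the_equality)
    show "fps_of_poly ?p = H_series A w v ell" by (rule H)
  next
    fix p assume "fps_of_poly p = H_series A w v ell"
    then have "fps_of_poly p = fps_of_poly ?p" unfolding H .
    then show "p = ?p" by (simp only: fps_of_poly_eq_iff)
  qed
qed

lemma coeff_H_poly: "coeff (H_poly A w v ell) q = int (cpoly.dim (perp Q \<inter> homogeneous_part q))"
  unfolding H_poly_eq by (rule coeff_dim_poly)

text \<open>The nontrivial degrees are the indices of nonzero coefficients of \<open>H_poly\<close>.
  The constants make degree 0 one of them, so the polynomial is nonzero and its degree is the
  maximum.\<close>

lemma Max_perp_degree: "Max {q. perp Q \<inter> homogeneous_part q \<noteq> {0}} = fdeg A w v ell"
proof -
  have set_eq: "{q. perp Q \<inter> homogeneous_part q \<noteq> {0}} = {q. coeff (H_poly A w v ell) q \<noteq> 0}"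
    by (simp add: coeff_H_poly dim_perp_eq_0_iff)
  have "1 \<in> perp Q \<inter> homogeneous_part 0"
    using one_in_perp_Q homogeneous_part_one by (rule IntI)
  moreover have "(1 :: 'n mpoly) \<notin> {0}" by simp
  ultimately have "perp Q \<inter> homogeneous_part 0 \<noteq> {0}" by metis
  then have "coeff (H_poly A w v ell) 0 \<noteq> 0"
    unfolding coeff_H_poly of_nat_eq_0_iff dim_perp_eq_0_iff .
  then have "H_poly A w v ell \<noteq> 0" by (rule contrapos_nn) simp
  then have "coeff (H_poly A w v ell) (degree (H_poly A w v ell)) \<noteq> 0"
    by (simp only: leading_coeff_0_iff not_False_eq_True)
  moreover have "finite {q. coeff (H_poly A w v ell) q \<noteq> 0}"
    by (rule finite_subset[of _ "{..degree (H_poly A w v ell)}"]) (use le_degree in blast, simp)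
  ultimately show ?thesis
    unfolding set_eq fdeg_def by (intro Max_eqI CollectI) (blast intro: le_degree)+
qed

text \<open>The value at 1 is the sum of the coefficients, which are the dimensions of the graded
  pieces.\<close>

lemma frank_eq: "int (frank A v m gp gm) = poly (H_poly A w v ell) 1"
proof -
  have "frank A v m gp gm = (\<Sum>q\<le>CARD('n). cpoly.dim (perp Q \<inter> homogeneous_part q))"
    unfolding frank_def Q_eq
    by (rule dim_perp_eq_sum)
       (use gens_homogeneous homogeneous_part_subset_Q in \<open>auto simp: Q_eq\<close>)
  then show ?thesis by (simp add: H_poly_eq poly_sum poly_monom)
qed

end

theorem theorem4p7:
  fixes A :: "int ^ 'n::finite ^ 'd::finite"
    and \<beta> :: "complex ^ 'd"
    and w :: "real ^ 'n"
    and v :: "complex ^ 'n"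
    and m :: nat
    and gp gm :: "nat \<Rightarrow> ('n \<Rightarrow>\<^sub>0 nat)"
    and L :: "'n \<Rightarrow> 'n mpoly"
    and ell :: "nat \<Rightarrow> 'n mpoly"
  assumes "rank (rat_matrix A) = CARD('d)"
    and "homogeneous_matrix A"
    and "generic_weight A w"
    and "fake_exponent A \<beta> w v"
    and "is_reduced_groebner_basis w (toric_ideal A) ((\<lambda>i. mon (gp i) - mon (gm i)) ` {1..m})"
    and "\<forall>i\<in>{1..m}. mon (gp i) \<in> initial_ideal w (toric_ideal A)"
    and "row_reduction A (nsupp v) L ell"
  shows
    "Abs_fps (\<lambda>q. int (cpoly.dim (perp (Q_ideal A v m gp gm) \<inter> homogeneous_part q)))
        = H_series A w v ell \<and>
     Max {q. perp (Q_ideal A v m gp gm) \<inter> homogeneous_part q \<noteq> {0}} = fdeg A w v ell \<and>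
     int (frank A v m gp gm) = poly (H_poly A w v ell) 1"
proof -
  interpret fake_exponent_setting A w m gp gm \<beta> v L ell "ell ` {1..CARD('d) - card (nsupp v)}"
    using assms by unfold_locales simp_all
  show ?thesis
    using H_series_eq Max_perp_degree frank_eq by blast
qed

end
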